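(* Let $X$ be a separable complex Banach space which admits an unconditional Schauder decomposition. Then $X$ is a universal Jamison space.
   Context: $\mathbb{T}=\{\lambda\in\mathbb{C} : |\lambda|=1\}$; $\mathcal{B}(X)$ is the algebra of bounded linear operators on $X$; $\sigma_p(T)=\{\lambda\in\mathbb{C} : \mathrm{Ker}(T-\lambda)\neq\{0\}\}$ is the point spectrum of $T\in\mathcal{B}(X)$, and $\sigma_p(T)\cap\mathbb{T}$ is its unimodular point spectrum. If $(n_k)_{k\ge 0}$ is an increasing sequence of positive integers, $T\in\mathcal{B}(X)$ is partially power-bounded with respect to $(n_k)_{k\ge 0}$ if $\sup_{k\ge 0}\|T^{n_k}\|<+\infty$. The sequence $(n_k)_{k\ge 0}$ is a Jamison sequence if for every separable complex Banach space $Y$ and every $T\in\mathcal{B}(Y)$ which is partially power-bounded with respect to $(n_k)_{k\ge 0}$, the set $\sigma_p(T)\cap\mathbb{T}$ is at most countable. A separable infinite-dimensional complex Banach space $X$ is a universal Jamison space if for any increasing sequence of positive integers $(n_k)_{k\ge 0}$ which is not a Jamison sequence, there exists $T\in\mathcal{B}(X)$ which is partially power-bounded with respect to $(n_k)_{k\ge 0}$ and such that $\sigma_p(T)\cap\mathbb{T}$ is uncountable. A separable infinite-dimensional complex Banach space $X$ admits an unconditional Schauder decomposition if there exists a sequence $(X_\ell)_{\ell\ge 1}$ of closed subspaces of $X$, all different from $\{0\}$, such that any $x\in X$ can be written in a unique way as an unconditionally convergent series $\sum_{\ell\ge 1}x_\ell$ with $x_\ell\in X_\ell$ for all $\ell\geq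 1$. *)

theory Defs
  imports "HOL-Analysis.Analysis"
begin

section \<open>Complex Banach spaces as types\<close>

class complex_banach = banach +
  fixes scaleC :: "complex \<Rightarrow> 'a \<Rightarrow> 'a" (infixr "*\<^sub>C" 75)
  assumes scaleC_add_right: "a *\<^sub>C (x + y) = a *\<^sub>C x + a *\<^sub>C y"
    and scaleC_add_left: "(a + b) *\<^sub>C x = a *\<^sub>C x + b *\<^sub>C x"
    and scaleC_scaleC: "a *\<^sub>C b *\<^sub>C x = (a * b) *\<^sub>C x"
    and scaleR_scaleC: "r *\<^sub>R x = complex_of_real r *\<^sub>C x"
    and norm_scaleC: "norm (a *\<^sub>C x) = cmod a * norm x"

global_interpretation complex_vector:
  vector_space "scaleC :: complex \<Rightarrow> 'a \<Rightarrow> 'a::complex_banach"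
proof
  show "1 *\<^sub>C x = x" for x :: 'a
    using scaleR_scaleC[of 1 x] by simp
qed (simp_all add: scaleC_add_right scaleC_add_left scaleC_scaleC)

instantiation complex :: complex_banach
begin
definition scaleC_complex :: "complex \<Rightarrow> complex \<Rightarrow> complex"
  where "scaleC_complex a x = a * x"
instance
  by standard (simp_all add: scaleC_complex_def algebra_simps scaleR_conv_of_real norm_mult)
end

definition separable_infinite_dimensional :: "'a::complex_banach itself \<Rightarrow> bool"
  where "separable_infinite_dimensional _ \<longleftrightarrow>
    separable_space (euclidean :: 'a topology) \<and>
    \<not> (\<exists>B :: 'a set. finite B \<and> complex_vector.span B = UNIV)"

text \<open>The series \<open>\<Sum>u\<^sub>l\<close> converges unconditionally to \<open>x\<close> iff \<open>(u has_sum x) UNIV\<close>, i.e. iff the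
  net of all its finite partial sums converges to \<open>x\<close>.  The subspaces are numbered from \<open>0\<close>.\<close>

definition admits_unconditional_Schauder_decomposition :: "'a::complex_banach itself \<Rightarrow> bool"
  where "admits_unconditional_Schauder_decomposition _ \<longleftrightarrow>
    separable_infinite_dimensional TYPE('a) \<and>
    (\<exists>M :: nat \<Rightarrow> 'a set.
       (\<forall>l. complex_vector.subspace (M l) \<and> closed (M l) \<and> M l \<noteq> {0}) \<and>
       (\<forall>x. \<exists>!u. (\<forall>l. u l \<in> M l) \<and> (u has_sum x) UNIV))"

definition bounded_operators :: "('a::complex_banach \<Rightarrow> 'a) set"
  where "bounded_operators = {T. Vector_Spaces.linear scaleC scaleC T \<and> bounded_linear T}"

definition partially_power_bounded :: "(nat \<Rightarrow> nat) \<Rightarrow> ('a::complex_banach \<Rightarrow> 'a) \<Rightarrow> bool"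
  where "partially_power_bounded n T \<longleftrightarrow> bdd_above (range (\<lambda>k. onorm (T ^^ n k)))"

definition point_spectrum :: "('a::complex_banach \<Rightarrow> 'a) \<Rightarrow> complex set"
  where "point_spectrum T = {\<mu>. {x. T x - \<mu> *\<^sub>C x = 0} \<noteq> {0}}"

definition unit_circle :: "complex set"
  where "unit_circle = {\<mu>. cmod \<mu> = 1}"


section \<open>Complex Banach spaces as structures, and Jamison sequences\<close>

text \<open>The definition of a Jamison sequence quantifies over all separable complex Banach spaces.
  As a formula cannot quantify over types, such a space is represented here by a carrier set with
  explicit operations.  A separable metric space has at most continuum many points, so carriers
  inside the type \<^typ>\<open>nat set\<close> give every separable complex Banach space up to isometric
  isomorphism.  The operator notions below are those above, with all operations explicit.
  Lemmas \<open>jamison_sequence_structure\<close> and \<open>jamison_sequence_type\<close> confirm that a Jamison sequence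
  has the defining property for separable complex Banach spaces over arbitrary types.\<close>

record 'b cspace =
  vecs :: "'b set"
  vzero :: 'b
  vadd :: "'b \<Rightarrow> 'b \<Rightarrow> 'b"
  vscale :: "complex \<Rightarrow> 'b \<Rightarrow> 'b"
  vnorm :: "'b \<Rightarrow> real"

text \<open>The value off the carrier is immaterial; \<^locale>\<open>Metric_space\<close> demands symmetry and
  nonnegativity there too.\<close>

definition vdist :: "'b cspace \<Rightarrow> 'b \<Rightarrow> 'b \<Rightarrow> real"
  where "vdist Y x y =
    (if x \<in> vecs Y \<and> y \<in> vecs Y then vnorm Y (vadd Y x (vscale Y (-1) y)) else 0)"

locale complex_banach_space =
  fixes Y :: "'b cspace"
  assumes zero_closed: "vzero Y \<in> vecs Y"
    and add_closed: "\<lbrakk>x \<in> vecs Y; y \<in> vecs Y\<rbrakk> \<Longrightarrow> vadd Y x y \<in> vecs Y"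
    and scale_closed: "x \<in> vecs Y \<Longrightarrow> vscale Y a x \<in> vecs Y"
    and add_assoc: "\<lbrakk>x \<in> vecs Y; y \<in> vecs Y; z \<in> vecs Y\<rbrakk> \<Longrightarrow>
      vadd Y (vadd Y x y) z = vadd Y x (vadd Y y z)"
    and add_commute: "\<lbrakk>x \<in> vecs Y; y \<in> vecs Y\<rbrakk> \<Longrightarrow> vadd Y x y = vadd Y y x"
    and add_zero: "x \<in> vecs Y \<Longrightarrow> vadd Y x (vzero Y) = x"
    and add_minus: "x \<in> vecs Y \<Longrightarrow> vadd Y x (vscale Y (-1) x) = vzero Y"
    and scale_add_right: "\<lbrakk>x \<in> vecs Y; y \<in> vecs Y\<rbrakk> \<Longrightarrow>
      vscale Y a (vadd Y x y) = vadd Y (vscale Y a x) (vscale Y a y)"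
    and scale_add_left: "x \<in> vecs Y \<Longrightarrow>
      vscale Y (a + b) x = vadd Y (vscale Y a x) (vscale Y b x)"
    and scale_scale: "x \<in> vecs Y \<Longrightarrow> vscale Y a (vscale Y b x) = vscale Y (a * b) x"
    and scale_one: "x \<in> vecs Y \<Longrightarrow> vscale Y 1 x = x"
    and norm_zero_iff: "x \<in> vecs Y \<Longrightarrow> vnorm Y x = 0 \<longleftrightarrow> x = vzero Y"
    and norm_triangle: "\<lbrakk>x \<in> vecs Y; y \<in> vecs Y\<rbrakk> \<Longrightarrow>
      vnorm Y (vadd Y x y) \<le> vnorm Y x + vnorm Y y"
    and norm_scale: "x \<in> vecs Y \<Longrightarrow> vnorm Y (vscale Y a x) = cmod a * vnorm Y x"
    and complete: "Metric_space.mcomplete (vecs Y) (vdist Y)"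

definition separable_cspace :: "'b cspace \<Rightarrow> bool"
  where "separable_cspace Y \<longleftrightarrow> separable_space (Metric_space.mtopology (vecs Y) (vdist Y))"

definition bounded_operators_on :: "'b cspace \<Rightarrow> ('b \<Rightarrow> 'b) set"
  where "bounded_operators_on Y = {T.
    (\<forall>x\<in>vecs Y. T x \<in> vecs Y) \<and>
    (\<forall>x\<in>vecs Y. \<forall>y\<in>vecs Y. T (vadd Y x y) = vadd Y (T x) (T y)) \<and>
    (\<forall>a. \<forall>x\<in>vecs Y. T (vscale Y a x) = vscale Y a (T x)) \<and>
    (\<exists>K. \<forall>x\<in>vecs Y. vnorm Y (T x) \<le> vnorm Y x * K)}"

definition opnorm_on :: "'b cspace \<Rightarrow> ('b \<Rightarrow> 'b) \<Rightarrow> real"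
  where "opnorm_on Y T = (SUP x\<in>vecs Y. vnorm Y (T x) / vnorm Y x)"

definition partially_power_bounded_on ::
    "'b cspace \<Rightarrow> (nat \<Rightarrow> nat) \<Rightarrow> ('b \<Rightarrow> 'b) \<Rightarrow> bool"
  where "partially_power_bounded_on Y n T \<longleftrightarrow> bdd_above (range (\<lambda>k. opnorm_on Y (T ^^ n k)))"

definition point_spectrum_on :: "'b cspace \<Rightarrow> ('b \<Rightarrow> 'b) \<Rightarrow> complex set"
  where "point_spectrum_on Y T =
    {\<mu>. {x \<in> vecs Y. vadd Y (T x) (vscale Y (-1) (vscale Y \<mu> x)) = vzero Y} \<noteq> {vzero Y}}"

definition jamison_sequence :: "(nat \<Rightarrow> nat) \<Rightarrow> bool"
  where "jamison_sequence n \<longleftrightarrow>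
    (\<forall>Y :: nat set cspace. complex_banach_space Y \<and> separable_cspace Y \<longrightarrow>
      (\<forall>T \<in> bounded_operators_on Y. partially_power_bounded_on Y n T \<longrightarrow>
        countable (point_spectrum_on Y T \<inter> unit_circle)))"

definition universal_jamison_space :: "'a::complex_banach itself \<Rightarrow> bool"
  where "universal_jamison_space _ \<longleftrightarrow>
    separable_infinite_dimensional TYPE('a) \<and>
    (\<forall>n. strict_mono n \<and> (\<forall>k. 0 < n k) \<and> \<not> jamison_sequence n \<longrightarrow>
      (\<exists>T \<in> (bounded_operators :: ('a \<Rightarrow> 'a) set).
        partially_power_bounded n T \<and> uncountable (point_spectrum T \<inter> unit_circle)))"


section \<open>Independence of the carrier type\<close>

context complex_banach_space
begin

lemma norm_nonneg: "x \<in> vecs Y \<Longrightarrow> 0 \<le> vnorm Y x"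
proof -
  assume x: "x \<in> vecs Y"
  have "vnorm Y (vadd Y x (vscale Y (-1) x)) \<le> vnorm Y x + vnorm Y (vscale Y (-1) x)"
    by (intro norm_triangle x scale_closed)
  moreover have "vnorm Y (vzero Y) = 0"
    by (simp add: norm_zero_iff zero_closed)
  ultimately show ?thesis
    using x by (simp add: add_minus norm_scale)
qed

lemma norm_minus: "x \<in> vecs Y \<Longrightarrow> vnorm Y (vscale Y (-1) x) = vnorm Y x"
  by (simp add: norm_scale)

lemma diff_eq_zeroD:
  assumes x: "x \<in> vecs Y" and y: "y \<in> vecs Y" and eq: "vadd Y x (vscale Y (-1) y) = vzero Y"
  shows "x = y"
proof -
  have "x = vadd Y x (vadd Y (vscale Y (-1) y) y)"
    using x y by (metis add_commute add_minus add_zero scale_closed)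
  also have "\<dots> = vadd Y (vzero Y) y"
    using x y eq by (metis add_assoc scale_closed)
  also have "\<dots> = y"
    using y by (metis add_commute add_zero zero_closed)
  finally show ?thesis .
qed

sublocale Metric_space "vecs Y" "vdist Y"
proof
  show "0 \<le> vdist Y x y" for x y
    by (simp add: vdist_def norm_nonneg add_closed scale_closed)
  show "vdist Y x y = vdist Y y x" for x y
  proof (cases "x \<in> vecs Y \<and> y \<in> vecs Y")
    case True
    then have x: "x \<in> vecs Y" and y: "y \<in> vecs Y"
      by auto
    have "vscale Y (-1) (vadd Y x (vscale Y (-1) y)) = vadd Y (vscale Y (-1) x) y"
      using x y by (simp add: scale_add_right scale_closed scale_scale scale_one)
    also have "\<dots> = vadd Y y (vscale Y (-1) x)"
      using x y by (simp add: add_commute scale_closed)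
    finally have "vnorm Y (vadd Y y (vscale Y (-1) x)) = vnorm Y (vadd Y x (vscale Y (-1) y))"
      using norm_minus x y add_closed scale_closed by metis
    with x y show ?thesis
      by (simp add: vdist_def)
  qed (auto simp: vdist_def)
  show "vdist Y x y = 0 \<longleftrightarrow> x = y" if "x \<in> vecs Y" "y \<in> vecs Y" for x y
    using that by (auto simp: vdist_def norm_zero_iff add_closed scale_closed add_minus
        intro: diff_eq_zeroD)
  show "vdist Y x z \<le> vdist Y x y + vdist Y y z"
    if x: "x \<in> vecs Y" and y: "y \<in> vecs Y" and z: "z \<in> vecs Y" for x y z
  proof -
    let ?m = "vscale Y (-1)"
    have cl: "?m y \<in> vecs Y" "?m z \<in> vecs Y"
      using y z scale_closed by auto
    have "vadd Y (?m y) (vadd Y y (?m z)) = vadd Y (vadd Y (?m y) y) (?m z)"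
      using y cl by (simp add: add_assoc)
    also have "\<dots> = vadd Y (vzero Y) (?m z)"
      using y cl by (metis add_commute add_minus)
    also have "\<dots> = ?m z"
      using cl by (metis add_commute add_zero zero_closed)
    finally have yz: "vadd Y (?m y) (vadd Y y (?m z)) = ?m z" .
    have "vadd Y (vadd Y x (?m y)) (vadd Y y (?m z)) = vadd Y x (vadd Y (?m y) (vadd Y y (?m z)))"
      using x y cl by (simp add: add_assoc add_closed)
    also have "\<dots> = vadd Y x (?m z)"
      by (simp add: yz)
    finally have "vnorm Y (vadd Y x (?m z)) \<le>
        vnorm Y (vadd Y x (?m y)) + vnorm Y (vadd Y y (?m z))"
      using norm_triangle[of "vadd Y x (?m y)" "vadd Y y (?m z)"] x y cl by (simp add: add_closed)
    with x y z show ?thesis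
      by (simp add: vdist_def)
  qed
qed

lemma separable_cspace_iff:
  "separable_cspace Y \<longleftrightarrow>
    (\<exists>C. countable C \<and> C \<subseteq> vecs Y \<and> (\<forall>x\<in>vecs Y. \<forall>r>0. \<exists>c\<in>C. vdist Y x c < r))"
proof -
  have "mtopology closure_of C = vecs Y \<longleftrightarrow> (\<forall>x\<in>vecs Y. \<forall>r>0. \<exists>c\<in>C. vdist Y x c < r)"
    if "C \<subseteq> vecs Y" for C
  proof -
    have "mtopology closure_of C = {x \<in> vecs Y. \<forall>r>0. \<exists>c\<in>C. vdist Y x c < r}"
      unfolding metric_closure_of using that by (intro Collect_cong conj_cong refl) (auto simp: subset_iff)
    then show ?thesis
      by (simp only: set_eq_iff mem_Collect_eq) blast
  qed
  then show ?thesis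
    unfolding separable_cspace_def separable_space_def topspace_mtopology
    by (intro ex_cong1 conj_cong refl)
qed

lemma separable_imp_inj:
  assumes "separable_cspace Y"
  obtains f :: "'b \<Rightarrow> nat set" where "inj_on f (vecs Y)"
proof -
  obtain C where C: "countable C" "C \<subseteq> vecs Y"
      and dense: "\<forall>x\<in>vecs Y. \<forall>r>0. \<exists>c\<in>C. vdist Y x c < r"
    using assms unfolding separable_cspace_iff by blast
  define f where "f x = {m. vdist Y x (from_nat_into C (fst (prod_decode m)))
      < inverse (real (Suc (snd (prod_decode m))))}" for x
  have inj: "x = y" if x: "x \<in> vecs Y" and y: "y \<in> vecs Y" and eq: "f x = f y" for x y
  proof (rule ccontr)
    assume "x \<noteq> y"
    then have "vdist Y x y / 2 > 0"
      using x y nonneg[of x y] zero[of x y] by linarith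
    from reals_Archimedean[OF this]
    obtain k where k: "inverse (real (Suc k)) < vdist Y x y / 2" ..
    obtain c where c: "c \<in> C" "vdist Y x c < inverse (real (Suc k))"
      using dense[rule_format, OF x, of "inverse (real (Suc k))"] by auto
    obtain i where i: "c = from_nat_into C i"
      using from_nat_into_surj[OF C(1) c(1)] by auto
    have "prod_encode (i, k) \<in> f x"
      using c i by (simp add: f_def)
    then have "prod_encode (i, k) \<in> f y"
      using eq by simp
    then have "vdist Y y c < inverse (real (Suc k))"
      using i by (simp add: f_def)
    moreover have "vdist Y x y \<le> vdist Y x c + vdist Y y c"
      using triangle[OF x subsetD[OF C(2) c(1)] y] by (simp only: commute[of c y])
    ultimately show False
      using c k by linarith
  qed
  show ?thesis
    by (rule that[of f], rule inj_onI, rule inj)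
qed

end

definition image_cspace :: "('b \<Rightarrow> 'c) \<Rightarrow> 'b cspace \<Rightarrow> 'c cspace"
  where "image_cspace f Y = (let g = inv_into (vecs Y) f in
    \<lparr>vecs = f ` vecs Y, vzero = f (vzero Y), vadd = (\<lambda>x y. f (vadd Y (g x) (g y))),
     vscale = (\<lambda>a x. f (vscale Y a (g x))), vnorm = (\<lambda>x. vnorm Y (g x))\<rparr>)"

context
  fixes Y :: "'b cspace" and f :: "'b \<Rightarrow> 'c"
  assumes Y: "complex_banach_space Y" and f: "inj_on f (vecs Y)"
begin

interpretation complex_banach_space Y
  by (rule Y)

lemma image_simps:
  "vecs (image_cspace f Y) = f ` vecs Y"
  "vzero (image_cspace f Y) = f (vzero Y)"
  "\<lbrakk>x \<in> vecs Y; y \<in> vecs Y\<rbrakk> \<Longrightarrow> vadd (image_cspace f Y) (f x) (f y) = f (vadd Y x y)"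
  "x \<in> vecs Y \<Longrightarrow> vscale (image_cspace f Y) a (f x) = f (vscale Y a x)"
  "x \<in> vecs Y \<Longrightarrow> vnorm (image_cspace f Y) (f x) = vnorm Y x"
  using f by (simp_all add: image_cspace_def Let_def)

lemma image_eq_iff: "\<lbrakk>x \<in> vecs Y; y \<in> vecs Y\<rbrakk> \<Longrightarrow> f x = f y \<longleftrightarrow> x = y"
  using f by (simp add: inj_on_eq_iff)

lemmas closed_rules = zero_closed add_closed scale_closed

lemma image_vdist:
  "\<lbrakk>x \<in> vecs Y; y \<in> vecs Y\<rbrakk> \<Longrightarrow> vdist (image_cspace f Y) (f x) (f y) = vdist Y x y"
  by (simp add: vdist_def image_simps closed_rules)

lemma image_vdist_inv:
  assumes "u \<in> f ` vecs Y" "v \<in> f ` vecs Y"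
  shows "vdist (image_cspace f Y) u v = vdist Y (inv_into (vecs Y) f u) (inv_into (vecs Y) f v)"
  using assms f by (auto simp: image_vdist)

lemma Metric_space_image: "Metric_space (f ` vecs Y) (vdist (image_cspace f Y))"
proof
  show "0 \<le> vdist (image_cspace f Y) x y" for x y
    by (cases "x \<in> f ` vecs Y \<and> y \<in> f ` vecs Y")
      (auto simp: image_vdist, auto simp: vdist_def image_simps)
  show "vdist (image_cspace f Y) x y = vdist (image_cspace f Y) y x" for x y
    by (cases "x \<in> f ` vecs Y \<and> y \<in> f ` vecs Y")
      (auto simp: image_vdist commute, auto simp: vdist_def image_simps)
  show "vdist (image_cspace f Y) x y = 0 \<longleftrightarrow> x = y" if "x \<in> f ` vecs Y" "y \<in> f ` vecs Y" for x y
    using that by (auto simp: image_vdist)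
  show "vdist (image_cspace f Y) x z \<le> vdist (image_cspace f Y) x y + vdist (image_cspace f Y) y z"
    if "x \<in> f ` vecs Y" "y \<in> f ` vecs Y" "z \<in> f ` vecs Y" for x y z
    using that by (auto simp: image_vdist triangle)
qed

lemma mcomplete_image: "Metric_space.mcomplete (f ` vecs Y) (vdist (image_cspace f Y))"
proof -
  interpret I: Metric_space "f ` vecs Y" "vdist (image_cspace f Y)"
    by (rule Metric_space_image)
  show ?thesis
    unfolding I.mcomplete_def
  proof (intro allI impI)
    fix \<sigma> assume \<sigma>: "I.MCauchy \<sigma>"
    then have ran: "\<sigma> k \<in> f ` vecs Y" for k
      unfolding I.MCauchy_def by blast
    define \<tau> where "\<tau> k = inv_into (vecs Y) f (\<sigma> k)" for k
    have \<tau>: "\<tau> k \<in> vecs Y" "\<sigma> k = f (\<tau> k)" for k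
      using ran[of k] f unfolding \<tau>_def by (simp_all add: inv_into_into f_inv_into_f)
    have "MCauchy \<tau>"
      using \<sigma> \<tau> unfolding MCauchy_def I.MCauchy_def by (auto simp: image_vdist)
    then obtain l where "limitin mtopology \<tau> l sequentially"
      using complete unfolding mcomplete_def by blast
    then have "limitin I.mtopology \<sigma> (f l) sequentially"
      unfolding limit_metric_sequentially I.limit_metric_sequentially
      using \<tau> by (auto simp: image_vdist)
    then show "\<exists>x. limitin I.mtopology \<sigma> x sequentially" ..
  qed
qed

lemma complex_banach_space_image: "complex_banach_space (image_cspace f Y)"
proof
  show "Metric_space.mcomplete (vecs (image_cspace f Y)) (vdist (image_cspace f Y))"
    using mcomplete_image by (simp add: image_simps)
  show "vadd (image_cspace f Y) x y = vadd (image_cspace f Y) y x"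
    if "x \<in> vecs (image_cspace f Y)" "y \<in> vecs (image_cspace f Y)" for x y
    using that by (auto simp: image_simps) (metis add_commute image_simps(3))
qed (auto simp: image_simps closed_rules add_assoc add_zero add_minus scale_add_right
    scale_add_left scale_scale scale_one norm_zero_iff norm_triangle norm_scale image_eq_iff)

lemma separable_image:
  assumes "separable_cspace Y" shows "separable_cspace (image_cspace f Y)"
proof -
  obtain C where C: "countable C" "C \<subseteq> vecs Y"
      and dense: "\<forall>x\<in>vecs Y. \<forall>r>0. \<exists>c\<in>C. vdist Y x c < r"
    using assms unfolding separable_cspace_iff by blast
  have "\<exists>c\<in>f ` C. vdist (image_cspace f Y) x c < r" if x: "x \<in> f ` vecs Y" and r: "r > 0" for x r
  proof -
    obtain z where z: "z \<in> vecs Y" "x = f z"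
      using x by blast
    obtain c where "c \<in> C" "vdist Y z c < r"
      using dense z r by blast
    then show ?thesis
      using z C(2) by (auto simp: image_vdist intro!: bexI[of _ c])
  qed
  with C show ?thesis
    unfolding complex_banach_space.separable_cspace_iff[OF complex_banach_space_image] image_simps
    by (intro exI[of _ "f ` C"]) auto
qed

context
  fixes T :: "'b \<Rightarrow> 'b"
  assumes T: "T \<in> bounded_operators_on Y"
begin

definition "image_op = f \<circ> T \<circ> inv_into (vecs Y) f"

lemma image_op_apply: "x \<in> vecs Y \<Longrightarrow> image_op (f x) = f (T x)"
  using f by (simp add: image_op_def)

lemma op_closed: "x \<in> vecs Y \<Longrightarrow> T x \<in> vecs Y"
  using T by (simp add: bounded_operators_on_def)

lemma op_pow_closed: "x \<in> vecs Y \<Longrightarrow> (T ^^ k) x \<in> vecs Y"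
  by (induction k) (auto simp: op_closed)

lemma image_op_pow: "x \<in> vecs Y \<Longrightarrow> (image_op ^^ k) (f x) = f ((T ^^ k) x)"
  by (induction k) (auto simp: image_op_apply op_pow_closed)

lemma image_op_bounded: "image_op \<in> bounded_operators_on (image_cspace f Y)"
  using T by (auto simp: bounded_operators_on_def image_simps image_op_apply closed_rules)

lemma image_op_opnorm: "opnorm_on (image_cspace f Y) (image_op ^^ k) = opnorm_on Y (T ^^ k)"
  unfolding opnorm_on_def image_simps image_image
  by (rule SUP_cong) (auto simp: image_op_pow image_simps op_pow_closed)

lemma image_op_spectrum: "point_spectrum_on (image_cspace f Y) image_op = point_spectrum_on Y T"
proof -
  have "{u \<in> vecs (image_cspace f Y). vadd (image_cspace f Y) (image_op u)
        (vscale (image_cspace f Y) (-1) (vscale (image_cspace f Y) \<mu> u)) = vzero (image_cspace f Y)} =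
      f ` {x \<in> vecs Y. vadd Y (T x) (vscale Y (-1) (vscale Y \<mu> x)) = vzero Y}" for \<mu>
    by (auto simp: image_simps image_op_apply op_closed closed_rules image_eq_iff)
  moreover have "f ` A = {f (vzero Y)} \<longleftrightarrow> A = {vzero Y}" if "A \<subseteq> vecs Y" for A
    using inj_on_image_eq_iff[OF f that, of "{vzero Y}"] zero_closed by simp
  ultimately show ?thesis
    unfolding point_spectrum_on_def image_simps by auto
qed

end

end

lemma jamison_sequence_structure:
  fixes Y :: "'b cspace"
  assumes n: "jamison_sequence n"
    and Y: "complex_banach_space Y" "separable_cspace Y"
    and T: "T \<in> bounded_operators_on Y" "partially_power_bounded_on Y n T"
  shows "countable (point_spectrum_on Y T \<inter> unit_circle)"
proof -
  obtain f :: "'b \<Rightarrow> nat set" where f: "inj_on f (vecs Y)"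
    using complex_banach_space.separable_imp_inj[OF Y] .
  let ?T = "image_op Y f T"
  have "partially_power_bounded_on (image_cspace f Y) n ?T"
    using T(2) by (simp add: partially_power_bounded_on_def image_op_opnorm[OF Y(1) f T(1)])
  then have "countable (point_spectrum_on (image_cspace f Y) ?T \<inter> unit_circle)"
    using n complex_banach_space_image[OF Y(1) f] separable_image[OF Y(1) f Y(2)]
      image_op_bounded[OF Y(1) f T(1)]
    unfolding jamison_sequence_def by blast
  then show ?thesis
    by (simp add: image_op_spectrum[OF Y(1) f T(1)])
qed

definition type_cspace :: "'a::complex_banach cspace"
  where "type_cspace =
    \<lparr>vecs = UNIV, vzero = 0, vadd = (+), vscale = (*\<^sub>C), vnorm = norm\<rparr>"

lemma scaleC_minus_one: "(- 1) *\<^sub>C x = - (x :: 'a::complex_banach)"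
  using complex_vector.scale_minus_left[of 1 x] complex_vector.scale_one[of x] by simp

lemma vdist_type_cspace: "vdist type_cspace = dist"
  by (auto simp: fun_eq_iff vdist_def type_cspace_def scaleC_minus_one dist_norm)

lemma complex_banach_space_type: "complex_banach_space (type_cspace :: 'a::complex_banach cspace)"
proof
  show "Metric_space.mcomplete (vecs (type_cspace :: 'a cspace)) (vdist type_cspace)"
    unfolding vdist_type_cspace
    by (simp add: type_cspace_def complete_UNIV)
qed (auto simp: type_cspace_def scaleC_minus_one algebra_simps scaleC_add_right scaleC_add_left
    scaleC_scaleC norm_scaleC norm_triangle_ineq)

lemma jamison_sequence_type:
  fixes T :: "'a::complex_banach \<Rightarrow> 'a"
  assumes "jamison_sequence n" "separable_space (euclidean :: 'a topology)"
    and T: "T \<in> bounded_operators" "partially_power_bounded n T"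
  shows "countable (point_spectrum T \<inter> unit_circle)"
proof -
  have "separable_cspace (type_cspace :: 'a cspace)"
    using assms(2) unfolding separable_cspace_def vdist_type_cspace by (simp add: type_cspace_def)
  moreover have "T \<in> bounded_operators_on type_cspace"
    using T(1) unfolding bounded_operators_def bounded_operators_on_def
    by (auto simp: type_cspace_def Vector_Spaces.linear_iff
        dest: bounded_linear.bounded)
  moreover have "partially_power_bounded_on type_cspace n T"
    using T(2) by (simp add: partially_power_bounded_def partially_power_bounded_on_def
        opnorm_on_def onorm_def type_cspace_def)
  moreover have "point_spectrum_on type_cspace T = point_spectrum T"
    by (simp add: point_spectrum_on_def point_spectrum_def type_cspace_def scaleC_minus_one)
  ultimately show ?thesis
    using jamison_sequence_structure[OF assms(1) complex_banach_space_type] by metis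
qed

end

theory Submission
  imports Defs
begin

text \<open>
  Suppose that \<open>n\<close> is not a Jamison sequence.  Unit eigenvectors of a partially power-bounded
  operator for two unimodular eigenvalues \<open>\<kappa>\<close>, \<open>\<mu>\<close> have distance at least a constant times
  \<open>sup\<^sub>k \<bar>\<kappa> ^ n k - \<mu> ^ n k\<bar>\<close>.  On a separable space an uncountable family of them has members that
  are arbitrarily close, so quotients of eigenvalues provide unimodular \<open>\<nu> \<noteq> 1\<close> for which all
  \<open>\<nu> ^ n k - 1\<close>, and \<open>\<nu> - 1\<close> too, are as small as desired (\<open>not_jamison_imp_small_powers\<close>).

  Given an unconditional decomposition with components \<open>M l\<close>, take unit vectors \<open>e l \<in> M l\<close>, bounded
  functionals \<open>\<phi> l\<close> that factor through the coordinate in \<open>M l\<close> and have the value \<open>1\<close> at \<open>e l\<close>, and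
  the binary tree on the indices in which \<open>l\<close> has the parent \<open>l div 2\<close>.  The vectors
  \<open>u l = u (l div 2) + (1/2) ^ l e l\<close> are to be eigenvectors of \<open>T\<close>, with eigenvalues \<open>\<kappa> l\<close> that
  differ from \<open>\<kappa> (l div 2)\<close> by a factor \<open>1\<close> or \<open>\<nu> l\<close>.  This dictates
  \<open>T = D + \<Sum>\<^sub>l 2 ^ l (\<kappa> l - \<kappa> (l div 2)) \<phi> l \<otimes> u (l div 2)\<close>, where \<open>D\<close> multiplies the component in
  \<open>M l\<close> by \<open>\<kappa> l\<close>, and an easy induction shows that \<open>T ^^ m\<close> is given by the same formula with
  \<open>\<kappa> l\<close> replaced by \<open>\<kappa> l ^ m\<close> (\<open>A_power\<close>).  The operators \<open>D ^^ m\<close> are bounded uniformly in \<open>m\<close>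
  because the decomposition is unconditional (\<open>uniformly_bounded_multipliers\<close>), and the series is
  absolutely convergent, uniformly in the exponents \<open>m = n k\<close>, if the \<open>\<nu> l\<close> are chosen close enough
  to \<open>1\<close> in the above sense.  Hence \<open>T\<close> is partially power-bounded.  Along each of the uncountably
  many branches of the tree eigenvectors and eigenvalues converge, to an eigenvector and its
  eigenvalue, and the eigenvalues so obtained are distinct since \<open>\<nu> l - 1\<close> decays fast
  (\<open>inj_ev_lim\<close>).

  Two pieces of functional analysis are developed on the way.  The functionals come from a
  Hahn-Banach argument: a minimal sublinear functional is linear.  The bound on multipliers rests on
  the open mapping argument for the norm \<open>sup\<^sub>F \<parallel>\<Sum>\<^sub>l\<^sub>\<in>\<^sub>F x\<^sub>l\<parallel>\<close>, with \<open>F\<close> ranging over the finite sets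
  of indices, and on the convexity of the norm.
\<close>

section \<open>Norming functionals\<close>

definition sublinear :: "('a::real_vector \<Rightarrow> real) \<Rightarrow> bool"
  where "sublinear p \<longleftrightarrow>
    (\<forall>x y. p (x + y) \<le> p x + p y) \<and> (\<forall>t>0. \<forall>x. p (t *\<^sub>R x) \<le> t * p x) \<and> p 0 = 0"

lemma sublinearD:
  assumes "sublinear p"
  shows "p (x + y) \<le> p x + p y" "t > 0 \<Longrightarrow> p (t *\<^sub>R x) \<le> t * p x" "p 0 = 0"
  using assms unfolding sublinear_def by auto

lemma sublinear_scaleR:
  assumes p: "sublinear p" and t: "t \<ge> 0"
  shows "p (t *\<^sub>R x) = t * p x"
proof (cases "t = 0")
  case False
  then have "t > 0" using t by simp
  moreover from this have "p ((1/t) *\<^sub>R t *\<^sub>R x) \<le> (1/t) * p (t *\<^sub>R x)"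
    by (intro sublinearD(2)[OF p]) auto
  ultimately show ?thesis
    using sublinearD(2)[OF p, of t x] by (simp add: field_simps)
qed (simp add: sublinearD(3)[OF p])

lemma sublinear_minus: "sublinear p \<Longrightarrow> 0 \<le> p x + p (- x)"
  using sublinearD(1)[of p x "- x"] sublinearD(3)[of p] by simp

text \<open>A chain of sublinear functionals below \<open>p\<close> is bounded below at \<open>x\<close> by \<open>- p (- x)\<close>, so its
  pointwise infimum is again one, and Zorn's lemma applies.\<close>

lemma minimal_sublinear_exists:
  assumes p: "sublinear (p :: 'a::real_vector \<Rightarrow> real)"
  obtains q where "sublinear q" "q \<le> p" "\<And>r. sublinear r \<Longrightarrow> r \<le> q \<Longrightarrow> r = q"
proof -
  define A where "A = {q. sublinear q \<and> q \<le> p}"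
  have "\<exists>m\<in>A. \<forall>a\<in>A. a \<le> m \<longrightarrow> a = m"
  proof (rule predicate_Zorn)
    show "partial_order_on A (relation_of (\<lambda>a b. b \<le> a) A)"
      by (rule partial_order_on_relation_ofI) auto
    fix C assume "C \<in> Chains (relation_of (\<lambda>a b. b \<le> a) A)"
    then have CA: "C \<subseteq> A" and chain: "\<And>q r. q \<in> C \<Longrightarrow> r \<in> C \<Longrightarrow> q \<le> r \<or> r \<le> q"
      unfolding Chains_def relation_of_def by auto
    show "\<exists>u\<in>A. \<forall>a\<in>C. u \<le> a"
    proof (cases "C = {}")
      case True
      then show ?thesis using p by (auto simp: A_def)
    next
      case False
      define u where "u x = (INF q\<in>C. q x)" for x
      have sl: "sublinear q" and le: "q \<le> p" if "q \<in> C" for q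
        using that CA by (auto simp: A_def)
      have lower: "- p (- x) \<le> q x" if "q \<in> C" for q x
        using sublinear_minus[OF sl[OF that], of x] le_funD[OF le[OF that], of "- x"] by simp
      have bdd: "bdd_below ((\<lambda>q. q x) ` C)" for x
        using lower by (auto intro!: bdd_belowI)
      have u_le: "u x \<le> q x" if "q \<in> C" for q x
        unfolding u_def using bdd that by (rule cINF_lower)
      have u_ge: "c \<le> u x" if "\<And>q. q \<in> C \<Longrightarrow> c \<le> q x" for c x
        unfolding u_def using False that by (rule cINF_greatest)
      have add2: "u (x + y) \<le> q x + r y" if qr: "q \<in> C" "r \<in> C" for q r x y
      proof -
        obtain s where s: "s \<in> C" "s \<le> q" "s \<le> r"
          using chain[OF qr] qr by blast
        have "u (x + y) \<le> s x + s y"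
          using u_le[OF s(1)] sublinearD(1)[OF sl[OF s(1)]] by (rule order_trans)
        then show ?thesis
          using s(2,3) by (meson add_mono le_funD order_trans)
      qed
      have "u (x + y) \<le> u x + u y" for x y
      proof -
        have "u (x + y) - u y \<le> q x" if "q \<in> C" for q
        proof -
          have "u (x + y) - q x \<le> u y"
            using add2[OF that] by (intro u_ge) (simp add: algebra_simps)
          then show ?thesis by simp
        qed
        then have "u (x + y) - u y \<le> u x" by (rule u_ge)
        then show ?thesis by simp
      qed
      moreover have "u (t *\<^sub>R x) \<le> t * u x" if t: "t > 0" for t x
      proof -
        have "u (t *\<^sub>R x) / t \<le> q x" if "q \<in> C" for q
        proof -
          have "u (t *\<^sub>R x) \<le> t * q x"
            using u_le[OF that] sublinearD(2)[OF sl[OF that] t] by (rule order_trans)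
          then show ?thesis using t by (simp add: field_simps)
        qed
        then have "u (t *\<^sub>R x) / t \<le> u x" by (rule u_ge)
        then show ?thesis using t by (simp add: field_simps)
      qed
      moreover have "u 0 = 0"
        using False by (simp add: u_def sublinearD(3)[OF sl])
      moreover have "u \<le> p"
        using False u_le le by (meson all_not_in_conv le_funD le_funI order_trans)
      ultimately have "u \<in> A"
        unfolding A_def sublinear_def by auto
      then show ?thesis
        using u_le by (auto simp: le_fun_def)
    qed
  qed
  then show ?thesis
    using that unfolding A_def by (auto intro: order_trans)
qed

text \<open>Every sublinear functional has a sublinear minorant that is linear along a prescribed line:
  it is the largest one with \<open>r (- y) \<le> - q y\<close>.\<close>

lemma sublinear_linear_along:
  assumes q: "sublinear (q :: 'a::real_vector \<Rightarrow> real)"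
  obtains r where "sublinear r" "r \<le> q" "r (- y) \<le> - q y"
proof -
  define g where "g x t = q (x + t *\<^sub>R y) - t * q y" for x t
  define r where "r x = (INF t\<in>{0..}. g x t)" for x
  have lower: "- q (- x) \<le> g x t" if "t \<ge> 0" for x t
    using sublinearD(1)[OF q, of "x + t *\<^sub>R y" "- x"] sublinear_scaleR[OF q that, of y]
    by (simp add: g_def)
  have bdd: "bdd_below (g x ` {0..})" for x
    using lower by (auto intro!: bdd_belowI)
  have r_le: "r x \<le> g x t" if "t \<ge> 0" for x t
    unfolding r_def using bdd that by (intro cINF_lower) auto
  have r_ge: "c \<le> r x" if "\<And>t. t \<ge> 0 \<Longrightarrow> c \<le> g x t" for c x
    unfolding r_def using that by (intro cINF_greatest) auto
  have add: "r (x + x') \<le> g x t + g x' s" if "t \<ge> 0" "s \<ge> 0" for x x' t s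
  proof -
    have "g (x + x') (t + s) \<le> g x t + g x' s"
      using sublinearD(1)[OF q, of "x + t *\<^sub>R y" "x' + s *\<^sub>R y"]
      by (simp add: g_def algebra_simps)
    then show ?thesis using r_le[of "t + s" "x + x'"] that by simp
  qed
  have "r (x + x') \<le> r x + r x'" for x x'
  proof -
    have "r (x + x') - r x' \<le> g x t" if "t \<ge> 0" for t
    proof -
      have "r (x + x') - g x t \<le> r x'"
        by (rule r_ge) (use add[OF that, of _ x x'] in \<open>simp add: diff_le_eq add.commute[of "g x' _"]\<close>)
      then show ?thesis by simp
    qed
    then have "r (x + x') - r x' \<le> r x" by (rule r_ge)
    then show ?thesis by simp
  qed
  moreover have "r (c *\<^sub>R x) \<le> c * r x" if c: "c > 0" for c x
  proof -
    have "r (c *\<^sub>R x) / c \<le> g x t" if t: "t \<ge> 0" for t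
    proof -
      have "g (c *\<^sub>R x) (c * t) = c * g x t"
        using sublinear_scaleR[OF q less_imp_le[OF c], of "x + t *\<^sub>R y"]
        by (simp add: g_def algebra_simps)
      then have "r (c *\<^sub>R x) \<le> c * g x t"
        using r_le[of "c * t" "c *\<^sub>R x"] c t by simp
      then show ?thesis using c by (simp add: field_simps)
    qed
    then have "r (c *\<^sub>R x) / c \<le> r x" by (rule r_ge)
    then show ?thesis using c by (simp add: field_simps)
  qed
  moreover have "r 0 = 0"
  proof -
    have "0 \<le> r 0"
      by (rule r_ge) (simp add: g_def sublinear_scaleR[OF q])
    moreover have "r 0 \<le> 0"
      using r_le[of 0 0] by (simp add: g_def sublinearD(3)[OF q])
    ultimately show ?thesis by simp
  qed
  ultimately have "sublinear r"
    unfolding sublinear_def by blast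
  moreover have "r \<le> q"
    using r_le[of 0] by (auto simp: le_fun_def g_def)
  moreover have "r (- y) \<le> - q y"
    using r_le[of 1 "- y"] by (simp add: g_def sublinearD(3)[OF q])
  ultimately show ?thesis by (rule that)
qed

text \<open>A minimal sublinear functional coincides with its minorants that are linear along a line,
  hence it is linear.\<close>

lemma linear_functional_below_sublinear:
  assumes p: "sublinear (p :: 'a::real_vector \<Rightarrow> real)"
  obtains f where "linear f" "\<And>x. f x \<le> p x" "f y = p y"
proof -
  obtain r where r: "sublinear r" "r \<le> p" "r (- y) \<le> - p y"
    using sublinear_linear_along[OF p] .
  obtain f where f: "sublinear f" "f \<le> r" and min: "\<And>s. sublinear s \<Longrightarrow> s \<le> f \<Longrightarrow> s = f"
    using minimal_sublinear_exists[OF r(1)] by blast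
  have minus: "f (- x) = - f x" for x
  proof -
    obtain s where "sublinear s" "s \<le> f" "s (- x) \<le> - f x"
      using sublinear_linear_along[OF f(1)] .
    with min have "f (- x) \<le> - f x" by metis
    then show ?thesis using sublinear_minus[OF f(1), of x] by simp
  qed
  have "linear f"
  proof (rule linearI)
    show "f (x + z) = f x + f z" for x z
      using sublinearD(1)[OF f(1), of x z] sublinearD(1)[OF f(1), of "x + z" "- z"] minus[of z]
      by simp
    show "f (t *\<^sub>R x) = t *\<^sub>R f x" for t x
    proof (cases "t \<ge> 0")
      case False
      then have "f ((- t) *\<^sub>R x) = (- t) * f x"
        by (intro sublinear_scaleR[OF f(1)]) simp
      then show ?thesis using minus[of "t *\<^sub>R x"] by simp
    qed (simp add: sublinear_scaleR[OF f(1)])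
  qed
  moreover have fp: "f x \<le> p x" for x
    using le_funD[OF f(2), of x] le_funD[OF r(2), of x] by simp
  moreover have "f y = p y"
    using minus[of y] le_funD[OF f(2), of "- y"] r(3) fp[of y] by simp
  ultimately show ?thesis by (rule that)
qed

definition bounded_clinear :: "('a::complex_banach \<Rightarrow> 'b::complex_banach) \<Rightarrow> bool"
  where "bounded_clinear f \<longleftrightarrow> bounded_linear f \<and> (\<forall>a x. f (a *\<^sub>C x) = a *\<^sub>C f x)"

lemma bounded_clinearI:
  assumes "\<And>x y. f (x + y) = f x + f y" "\<And>a x. f (a *\<^sub>C x) = a *\<^sub>C f x"
    "\<And>x. norm (f x) \<le> norm x * K"
  shows "bounded_clinear f"
  unfolding bounded_clinear_def
proof (intro conjI allI bounded_linear_intro[where K = K])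
  show "f (r *\<^sub>R x) = r *\<^sub>R f x" for r x
    unfolding scaleR_scaleC by (rule assms(2))
qed (rule assms)+

lemma bounded_clinearD:
  assumes "bounded_clinear f"
  shows "bounded_linear f" "f (a *\<^sub>C x) = a *\<^sub>C f x" "f (x + y) = f x + f y" "f (x - y) = f x - f y"
    "f 0 = 0"
  using assms unfolding bounded_clinear_def
  by (auto simp: bounded_linear.linear linear_add linear_diff linear_0)

lemma bounded_clinear_scaleC:
  "bounded_clinear (scaleC a :: 'a \<Rightarrow> 'a::complex_banach)"
  by (rule bounded_clinearI[where K = "cmod a"])
    (auto simp: scaleC_add_right scaleC_scaleC norm_scaleC mult.commute)

lemma bounded_operators_iff:
  fixes T :: "'a::complex_banach \<Rightarrow> 'a"
  shows "T \<in> bounded_operators \<longleftrightarrow> bounded_clinear T"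
  unfolding bounded_operators_def bounded_clinear_def
  by (auto simp: Vector_Spaces.linear_iff bounded_linear.linear linear_add
      complex_vector.vector_space_axioms)

text \<open>The real part of the functional is a real functional below the norm; a complex functional is
  recovered from its real part \<open>f\<close> as \<open>x \<mapsto> f x - \<i> f (\<i> x)\<close>.\<close>

lemma separating_functional:
  fixes e :: "'a::complex_banach"
  assumes "e \<noteq> 0"
  obtains \<phi> :: "'a \<Rightarrow> complex" where "bounded_clinear \<phi>" "\<phi> e = 1"
proof -
  have "sublinear (norm :: 'a \<Rightarrow> real)"
    by (simp add: sublinear_def norm_triangle_ineq)
  then obtain f :: "'a \<Rightarrow> real" where f: "linear f" "\<And>x. f x \<le> norm x" "f e = norm e"
    using linear_functional_below_sublinear[of norm e] by metis
  define \<psi> where "\<psi> x = Complex (f x) (- f (\<i> *\<^sub>C x))" for x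
  have absf: "\<bar>f x\<bar> \<le> norm x" for x
    using f(2)[of x] f(2)[of "- x"] linear_neg[OF f(1), of x] by auto
  have "bounded_clinear \<psi>"
  proof (rule bounded_clinearI[where K = 2])
    show "\<psi> (x + y) = \<psi> x + \<psi> y" for x y
      by (simp add: \<psi>_def linear_add[OF f(1)] scaleC_add_right complex_eq_iff)
    show "\<psi> (a *\<^sub>C x) = a *\<^sub>C \<psi> x" for a x
    proof -
      have split: "f (c *\<^sub>C x) = Re c * f x + Im c * f (\<i> *\<^sub>C x)" for c
      proof -
        have "c *\<^sub>C x = Re c *\<^sub>R x + Im c *\<^sub>R \<i> *\<^sub>C x"
          by (simp add: scaleR_scaleC scaleC_scaleC flip: scaleC_add_left)
            (simp add: complex_eq mult.commute)
        then show ?thesis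
          by (simp add: linear_add[OF f(1)] linear_cmul[OF f(1)])
      qed
      show ?thesis
        using split[of a] split[of "\<i> * a"]
        by (simp add: \<psi>_def scaleC_complex_def complex_eq_iff scaleC_scaleC)
    qed
    show "norm (\<psi> x) \<le> norm x * 2" for x
      using cmod_le[of "\<psi> x"] absf[of x] absf[of "\<i> *\<^sub>C x"] by (simp add: \<psi>_def norm_scaleC)
  qed
  moreover have e: "\<psi> e \<noteq> 0"
    using f(3) assms by (simp add: \<psi>_def complex_eq_iff)
  ultimately have "bounded_clinear (\<lambda>x. (1 / \<psi> e) *\<^sub>C \<psi> x)"
    unfolding bounded_clinear_def
    by (auto simp: scaleC_complex_def intro: bounded_linear_compose[OF bounded_linear_divide])
  then show ?thesis
    using that[of "\<lambda>x. (1 / \<psi> e) *\<^sub>C \<psi> x"] e by (simp add: scaleC_complex_def)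
qed

section \<open>Unconditional convergence and bounded multipliers\<close>

text \<open>The norm is convex, so on the cube of coefficients it is largest at a vertex, that is, at a
  subsum.\<close>

lemma norm_convex_multiplier_le:
  fixes x :: "'b \<Rightarrow> 'a::real_normed_vector"
  assumes "finite F" "\<And>l. l \<in> F \<Longrightarrow> 0 \<le> t l \<and> t l \<le> 1"
    "\<And>G. G \<subseteq> F \<Longrightarrow> norm (y + sum x G) \<le> C"
  shows "norm (y + (\<Sum>l\<in>F. t l *\<^sub>R x l)) \<le> C"
  using assms
proof (induction F arbitrary: y rule: finite_induct)
  case empty
  then show ?case by simp
next
  case (insert a F)
  have "norm ((y + t a *\<^sub>R x a) + (\<Sum>l\<in>F. t l *\<^sub>R x l)) \<le> C"
  proof (rule insert.IH)
    fix G assume G: "G \<subseteq> F"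
    have t: "0 \<le> t a" "t a \<le> 1" using insert.prems(1) by auto
    have "a \<notin> G" "finite G" using G insert.hyps finite_subset by auto
    then have C: "norm (y + sum x G) \<le> C" "norm (y + x a + sum x G) \<le> C"
      using insert.prems(2)[of G] insert.prems(2)[of "insert a G"] G
      by (auto simp: add.assoc)
    have "(y + t a *\<^sub>R x a) + sum x G = (1 - t a) *\<^sub>R (y + sum x G) + t a *\<^sub>R (y + x a + sum x G)"
      by (simp add: algebra_simps)
    also have "norm \<dots> \<le> (1 - t a) * norm (y + sum x G) + t a * norm (y + x a + sum x G)"
      by (rule order_trans[OF norm_triangle_ineq]) (use t in simp)
    also have "\<dots> \<le> (1 - t a) * C + t a * C"
      using t C by (intro add_mono mult_left_mono) auto
    finally show "norm ((y + t a *\<^sub>R x a) + sum x G) \<le> C"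
      by (simp add: algebra_simps)
  qed (use insert.prems in auto)
  then show ?case using insert.hyps by (simp add: add.assoc)
qed

text \<open>The factor \<open>4\<close> comes from splitting a complex number of modulus at most \<open>1\<close> into the positive
  and negative parts of its real and imaginary parts.\<close>

lemma norm_complex_multiplier_le:
  fixes x :: "'b \<Rightarrow> 'a::complex_banach"
  assumes F: "finite F" and \<theta>: "\<And>l. l \<in> F \<Longrightarrow> cmod (\<theta> l) \<le> 1"
    and C: "\<And>G. G \<subseteq> F \<Longrightarrow> norm (sum x G) \<le> C"
  shows "norm (\<Sum>l\<in>F. \<theta> l *\<^sub>C x l) \<le> 4 * C"
proof -
  define S where "S t = (\<Sum>l\<in>F. t l *\<^sub>R x l)" for t
  have S: "norm (S t) \<le> C" if "\<And>l. l \<in> F \<Longrightarrow> 0 \<le> t l \<and> t l \<le> 1" for t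
    using norm_convex_multiplier_le[OF F that, where y = 0 and x = x and C = C] C by (simp add: S_def)
  have part: "norm (S (\<lambda>l. max 0 (p (\<theta> l)))) \<le> C"
    if "\<And>z. \<bar>p z\<bar> \<le> cmod z" for p
  proof (rule S)
    fix l assume "l \<in> F"
    then have "p (\<theta> l) \<le> 1"
      using that[of "\<theta> l"] \<theta>[of l] by simp
    then show "0 \<le> max 0 (p (\<theta> l)) \<and> max 0 (p (\<theta> l)) \<le> 1" by simp
  qed
  let ?rp = "S (\<lambda>l. max 0 (Re (\<theta> l)))" and ?rn = "S (\<lambda>l. max 0 (- Re (\<theta> l)))"
    and ?ip = "S (\<lambda>l. max 0 (Im (\<theta> l)))" and ?in = "S (\<lambda>l. max 0 (- Im (\<theta> l)))"
  have split: "\<theta> l *\<^sub>C x l =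
      (max 0 (Re (\<theta> l)) *\<^sub>R x l - max 0 (- Re (\<theta> l)) *\<^sub>R x l) +
      \<i> *\<^sub>C (max 0 (Im (\<theta> l)) *\<^sub>R x l - max 0 (- Im (\<theta> l)) *\<^sub>R x l)" for l
  proof -
    have "\<theta> l *\<^sub>C x l = Re (\<theta> l) *\<^sub>R x l + \<i> *\<^sub>C (Im (\<theta> l) *\<^sub>R x l)"
      by (simp add: scaleR_scaleC scaleC_scaleC flip: scaleC_add_left complex_eq)
    moreover have "max 0 r - max 0 (- r) = r" for r :: real by simp
    ultimately show ?thesis by (simp only: flip: scaleR_diff_left)
  qed
  have "(\<Sum>l\<in>F. \<theta> l *\<^sub>C x l) = (?rp - ?rn) + \<i> *\<^sub>C (?ip - ?in)"
    unfolding split S_def sum.distrib sum_subtractf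
    by (simp only: sum_subtractf flip: complex_vector.scale_sum_right)
  then have "norm (\<Sum>l\<in>F. \<theta> l *\<^sub>C x l) = norm ((?rp - ?rn) + \<i> *\<^sub>C (?ip - ?in))"
    by (rule arg_cong)
  also have "\<dots> \<le> (norm ?rp + norm ?rn) + (norm ?ip + norm ?in)"
    by (intro order_trans[OF norm_triangle_ineq] add_mono) (simp_all add: norm_scaleC norm_triangle_ineq4)
  also have "\<dots> \<le> (C + C) + (C + C)"
    by (intro add_mono part) (auto simp: abs_Re_le_cmod abs_Im_le_cmod)
  finally show ?thesis by simp
qed

text \<open>In this form the Cauchy criterion speaks of finite subsums only, which is what the estimate
  above for multipliers can be applied to.\<close>

lemma summable_on_nat_Cauchy_iff:
  fixes f :: "nat \<Rightarrow> 'a::banach"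
  shows "f summable_on UNIV \<longleftrightarrow>
    (\<forall>\<epsilon>>0. \<exists>F\<^sub>0. finite F\<^sub>0 \<and> (\<forall>F. finite F \<longrightarrow> F \<inter> F\<^sub>0 = {} \<longrightarrow> norm (sum f F) \<le> \<epsilon>))"
    (is "_ \<longleftrightarrow> ?C")
proof
  assume "f summable_on UNIV"
  then obtain s where s: "(f has_sum s) UNIV"
    unfolding summable_on_def ..
  show ?C
  proof (intro allI impI)
    fix \<epsilon> :: real assume \<epsilon>: "\<epsilon> > 0"
    then have "\<forall>\<^sub>F F in finite_subsets_at_top UNIV. dist (sum f F) s < \<epsilon> / 2"
      using s unfolding has_sum_def by (intro tendstoD) auto
    then obtain F\<^sub>0 where F\<^sub>0: "finite F\<^sub>0" "\<And>F. finite F \<Longrightarrow> F\<^sub>0 \<subseteq> F \<Longrightarrow> dist (sum f F) s < \<epsilon> / 2"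
      unfolding eventually_finite_subsets_at_top by auto
    have "norm (sum f F) \<le> \<epsilon>" if F: "finite F" "F \<inter> F\<^sub>0 = {}" for F
    proof -
      have "sum f F = sum f (F \<union> F\<^sub>0) - sum f F\<^sub>0"
        using F F\<^sub>0(1) by (simp add: sum.union_disjoint)
      moreover have "dist (sum f (F \<union> F\<^sub>0)) (sum f F\<^sub>0) < \<epsilon>"
        by (rule dist_triangle_half_l[OF F\<^sub>0(2) F\<^sub>0(2)]) (use F F\<^sub>0(1) in auto)
      ultimately show ?thesis by (simp add: dist_norm)
    qed
    with F\<^sub>0(1) show "\<exists>F\<^sub>0. finite F\<^sub>0 \<and> (\<forall>F. finite F \<longrightarrow> F \<inter> F\<^sub>0 = {} \<longrightarrow> norm (sum f F) \<le> \<epsilon>)"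
      by blast
  qed
next
  assume C: ?C
  have near: "\<exists>N. \<forall>n\<ge>N. \<forall>F. finite F \<longrightarrow> {..<n} \<subseteq> F \<longrightarrow> norm (sum f F - sum f {..<n}) \<le> \<epsilon>"
    if \<epsilon>: "\<epsilon> > 0" for \<epsilon>
  proof -
    obtain F\<^sub>0 where F\<^sub>0: "finite F\<^sub>0" "\<And>F. finite F \<Longrightarrow> F \<inter> F\<^sub>0 = {} \<Longrightarrow> norm (sum f F) \<le> \<epsilon>"
      using C[rule_format, OF \<epsilon>] by blast
    obtain N where N: "F\<^sub>0 \<subseteq> {..<N}"
      using F\<^sub>0(1) finite_nat_iff_bounded by blast
    have "norm (sum f F - sum f {..<n}) \<le> \<epsilon>" if "n \<ge> N" "finite F" "{..<n} \<subseteq> F" for n F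
    proof -
      have "sum f F - sum f {..<n} = sum f (F - {..<n})"
        using that by (simp add: sum_diff)
      moreover have "norm (sum f (F - {..<n})) \<le> \<epsilon>"
        using that N by (intro F\<^sub>0(2)) auto
      ultimately show ?thesis by simp
    qed
    then show ?thesis by blast
  qed
  have "Cauchy (\<lambda>n. sum f {..<n})"
  proof (rule CauchyI')
    fix \<epsilon> :: real assume "\<epsilon> > 0"
    from near[OF half_gt_zero[OF this]]
    obtain N where N: "\<And>n F. n \<ge> N \<Longrightarrow> finite F \<Longrightarrow> {..<n} \<subseteq> F \<Longrightarrow>
        norm (sum f F - sum f {..<n}) \<le> \<epsilon> / 2"
      by blast
    have "dist (sum f {..<m}) (sum f {..<n}) < \<epsilon>" if "m \<ge> N" "n > m" for m n
    proof -
      have "norm (sum f {..<n} - sum f {..<m}) \<le> \<epsilon> / 2"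
        using that by (intro N) auto
      then show ?thesis
        using \<open>\<epsilon> > 0\<close> by (simp add: dist_norm norm_minus_commute)
    qed
    then show "\<exists>M. \<forall>m\<ge>M. \<forall>n>m. dist (sum f {..<m}) (sum f {..<n}) < \<epsilon>"
      by blast
  qed
  then obtain s where s: "(\<lambda>n. sum f {..<n}) \<longlonglongrightarrow> s"
    using Cauchy_convergent convergent_def by blast
  have "(f has_sum s) UNIV"
    unfolding has_sum_def
  proof (rule tendstoI)
    fix \<epsilon> :: real assume \<epsilon>: "\<epsilon> > 0"
    then have "\<epsilon> / 3 > 0" by simp
    from near[OF this]
    obtain N where N: "\<And>n F. n \<ge> N \<Longrightarrow> finite F \<Longrightarrow> {..<n} \<subseteq> F \<Longrightarrow>
        norm (sum f F - sum f {..<n}) \<le> \<epsilon> / 3"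
      by blast
    obtain N' where N': "\<And>n. n \<ge> N' \<Longrightarrow> norm (sum f {..<n} - s) < \<epsilon> / 3"
      using LIMSEQ_D[OF s, of "\<epsilon> / 3"] \<epsilon> by auto
    define n where "n = max N N'"
    have "dist (sum f F) s < \<epsilon>" if "finite F" "{..<n} \<subseteq> F" for F
    proof -
      have "norm (sum f F - s) \<le> norm (sum f F - sum f {..<n}) + norm (sum f {..<n} - s)"
        using norm_triangle_ineq[of "sum f F - sum f {..<n}" "sum f {..<n} - s"] by simp
      also have "\<dots> < \<epsilon>"
        using N[of n F] N'[of n] that \<epsilon> by (simp add: n_def)
      finally show ?thesis by (simp add: dist_norm)
    qed
    then show "\<forall>\<^sub>F F in finite_subsets_at_top UNIV. dist (sum f F) s < \<epsilon>"
      unfolding eventually_finite_subsets_at_top by (intro exI[of _ "{..<n}"]) auto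
  qed
  then show "f summable_on UNIV"
    unfolding summable_on_def ..
qed

lemma summable_on_imp_bounded_subsums:
  fixes f :: "nat \<Rightarrow> 'a::banach"
  assumes "f summable_on UNIV"
  obtains C where "\<And>F. finite F \<Longrightarrow> norm (sum f F) \<le> C"
proof -
  obtain F\<^sub>0 where F\<^sub>0: "finite F\<^sub>0" "\<And>F. finite F \<Longrightarrow> F \<inter> F\<^sub>0 = {} \<Longrightarrow> norm (sum f F) \<le> 1"
    using assms[unfolded summable_on_nat_Cauchy_iff, rule_format, of 1] by auto
  have "norm (sum f F) \<le> (\<Sum>l\<in>F\<^sub>0. norm (f l)) + 1" if F: "finite F" for F
  proof -
    have "sum f F = sum f (F \<inter> F\<^sub>0) + sum f (F - F\<^sub>0)"
      using F by (rule sum.Int_Diff)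
    also have "norm \<dots> \<le> norm (sum f (F \<inter> F\<^sub>0)) + norm (sum f (F - F\<^sub>0))"
      by (rule norm_triangle_ineq)
    also have "\<dots> \<le> (\<Sum>l\<in>F \<inter> F\<^sub>0. norm (f l)) + 1"
      using F by (intro add_mono norm_sum F\<^sub>0(2)) auto
    also have "\<dots> \<le> (\<Sum>l\<in>F\<^sub>0. norm (f l)) + 1"
      using F\<^sub>0(1) by (intro add_mono sum_mono2) auto
    finally show ?thesis .
  qed
  then show ?thesis by (rule that)
qed

lemma has_sum_norm_le:
  fixes f :: "'b \<Rightarrow> 'a::real_normed_vector"
  assumes "(f has_sum s) A" "\<And>F. finite F \<Longrightarrow> F \<subseteq> A \<Longrightarrow> norm (sum f F) \<le> C"
  shows "norm s \<le> C"
  using assms unfolding has_sum_def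
  by (intro Lim_norm_ubound[of "finite_subsets_at_top A" "sum f"])
    (auto intro: eventually_finite_subsets_at_top_weakI)

lemma summable_on_multiplier:
  fixes x :: "nat \<Rightarrow> 'a::complex_banach"
  assumes "x summable_on UNIV" and \<theta>: "\<And>l. cmod (\<theta> l) \<le> 1"
  shows "(\<lambda>l. \<theta> l *\<^sub>C x l) summable_on UNIV"
  unfolding summable_on_nat_Cauchy_iff
proof (intro allI impI)
  fix \<epsilon> :: real assume "\<epsilon> > 0"
  then have "\<epsilon> / 4 > 0" by simp
  then obtain F\<^sub>0 where F\<^sub>0: "finite F\<^sub>0" "\<And>F. finite F \<Longrightarrow> F \<inter> F\<^sub>0 = {} \<Longrightarrow> norm (sum x F) \<le> \<epsilon> / 4"
    using assms(1)[unfolded summable_on_nat_Cauchy_iff, rule_format, of "\<epsilon> / 4"] by blast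
  have "norm (\<Sum>l\<in>F. \<theta> l *\<^sub>C x l) \<le> 4 * (\<epsilon> / 4)" if "finite F" "F \<inter> F\<^sub>0 = {}" for F
    by (rule norm_complex_multiplier_le[OF that(1) \<theta> F\<^sub>0(2)])
      (use that finite_subset in auto)
  with F\<^sub>0(1) show "\<exists>F\<^sub>0. finite F\<^sub>0 \<and>
      (\<forall>F. finite F \<longrightarrow> F \<inter> F\<^sub>0 = {} \<longrightarrow> norm (\<Sum>l\<in>F. \<theta> l *\<^sub>C x l) \<le> \<epsilon>)"
    by auto
qed

section \<open>Coordinates of an unconditional decomposition\<close>

locale unconditional_decomposition =
  fixes M :: "nat \<Rightarrow> 'a::complex_banach set"
  assumes subspace: "complex_vector.subspace (M l)"
    and closed: "closed (M l)"
    and expansion: "\<exists>!u. (\<forall>l. u l \<in> M l) \<and> (u has_sum x) UNIV"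
begin

definition coord :: "'a \<Rightarrow> nat \<Rightarrow> 'a"
  where "coord x = (THE u. (\<forall>l. u l \<in> M l) \<and> (u has_sum x) UNIV)"

lemma coord_in: "coord x l \<in> M l"
  and coord_has_sum: "(coord x has_sum x) UNIV"
  using theI'[OF expansion[of x]] unfolding coord_def by auto

lemma coord_eqI: "(\<And>l. u l \<in> M l) \<Longrightarrow> (u has_sum x) UNIV \<Longrightarrow> coord x = u"
  using the1_equality[OF expansion[of x]] unfolding coord_def by auto

lemma coord_add: "coord (x + y) l = coord x l + coord y l"
  using coord_eqI[OF complex_vector.subspace_add[OF subspace coord_in coord_in]
      has_sum_add[OF coord_has_sum coord_has_sum], of x y] by simp

lemma coord_scaleC: "coord (a *\<^sub>C x) l = a *\<^sub>C coord x l"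
proof -
  have "((\<lambda>l. a *\<^sub>C coord x l) has_sum a *\<^sub>C x) UNIV"
    using has_sum_bounded_linear[OF bounded_clinearD(1)[OF bounded_clinear_scaleC] coord_has_sum] .
  then show ?thesis
    using coord_eqI[OF complex_vector.subspace_scale[OF subspace coord_in]] by simp
qed

lemma coord_scaleR: "coord (a *\<^sub>R x) l = a *\<^sub>R coord x l"
  by (simp add: scaleR_scaleC coord_scaleC)

lemma coord_diff: "coord (x - y) l = coord x l - coord y l"
  using coord_add[of x "- y" l] coord_scaleR[of "- 1" y l] by simp

lemma coord_zero: "coord 0 l = 0"
  using coord_diff[of 0 0 l] by simp

lemma coord_sum: "coord (sum f S) l = (\<Sum>k\<in>S. coord (f k) l)"
  by (induction S rule: infinite_finite_induct) (simp_all add: coord_zero coord_add)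

lemma coord_component:
  assumes "e \<in> M m"
  shows "coord e l = (if l = m then e else 0)"
proof -
  have "coord e = (\<lambda>l. if l = m then e else 0)"
  proof (rule coord_eqI)
    show "(if l = m then e else 0) \<in> M l" for l
      using assms subspace by (simp add: complex_vector.subspace_0)
    show "((\<lambda>l. if l = m then e else 0) has_sum e) UNIV"
      by (rule has_sum_finite_neutralI[where B = "{m}"]) auto
  qed
  then show ?thesis by simp
qed

definition subsums_le :: "real \<Rightarrow> 'a set"
  where "subsums_le C = {x. \<forall>F. finite F \<longrightarrow> norm (\<Sum>l\<in>F. coord x l) \<le> C}"

lemma subsums_leD: "x \<in> subsums_le C \<Longrightarrow> finite F \<Longrightarrow> norm (\<Sum>l\<in>F. coord x l) \<le> C"
  by (simp add: subsums_le_def)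

lemma subsums_le_scaleR:
  assumes "x \<in> subsums_le C"
  shows "t *\<^sub>R x \<in> subsums_le (\<bar>t\<bar> * C)"
  using assms by (auto simp: subsums_le_def coord_scaleR mult_left_mono simp flip: scaleR_right.sum)

lemma subsums_le_half_diff:
  assumes "x \<in> subsums_le C" "y \<in> subsums_le C"
  shows "(1/2) *\<^sub>R (x - y) \<in> subsums_le C"
  unfolding subsums_le_def
proof (intro CollectI allI impI)
  fix F :: "nat set" assume "finite F"
  then have "norm ((\<Sum>l\<in>F. coord x l) - (\<Sum>l\<in>F. coord y l)) \<le> C + C"
    by (intro order_trans[OF norm_triangle_ineq4] add_mono subsums_leD assms)
  then show "norm (\<Sum>l\<in>F. coord ((1/2) *\<^sub>R (x - y)) l) \<le> C"
    by (simp add: coord_scaleR coord_diff sum_subtractf flip: scaleR_right.sum)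
qed

text \<open>The sets \<open>subsums_le n\<close> cover the space, so by Baire the closure of one of them contains a
  ball, and by symmetry and convexity a ball around \<open>0\<close>.\<close>

lemma subsums_le_dense:
  "\<exists>K\<ge>0. \<forall>y. \<forall>\<delta>>0. \<exists>a\<in>subsums_le (K * norm y). norm (y - a) < \<delta>"
proof -
  have cover: "\<exists>n::nat. x \<in> subsums_le (real n)" for x
  proof -
    obtain C where C: "\<And>F. finite F \<Longrightarrow> norm (\<Sum>l\<in>F. coord x l) \<le> C"
      using summable_on_imp_bounded_subsums[OF has_sum_imp_summable[OF coord_has_sum]] by blast
    obtain n where "C \<le> real n"
      using real_arch_simple by blast
    with C show ?thesis
      unfolding subsums_le_def by (intro exI[of _ n]) (auto intro: order_trans)
  qed
  let ?G = "range (\<lambda>n::nat. closure (subsums_le (real n)))"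
  have "\<exists>n::nat. interior (closure (subsums_le (real n))) \<noteq> {}"
  proof (rule ccontr)
    assume "\<not> ?thesis"
    then have "Met_TC.mtopology interior_of (\<Union> ?G) = ({} :: 'a set)"
      by (intro Met_TC.metric_Baire_category_alt) (auto simp: complete_UNIV)
    moreover have "\<Union> ?G = UNIV"
      using cover closure_subset by blast
    ultimately show False by simp
  qed
  then obtain n :: nat and x\<^sub>0 where "x\<^sub>0 \<in> interior (closure (subsums_le (real n)))"
    by blast
  then obtain r where r: "r > 0" "ball x\<^sub>0 r \<subseteq> closure (subsums_le (real n))"
    unfolding mem_interior by blast
  have near0: "\<exists>a\<in>subsums_le (real n). norm (y - a) < \<delta>" if y: "norm y < r" and \<delta>: "\<delta> > 0" for y \<delta>
  proof -
    have "x\<^sub>0 + y \<in> closure (subsums_le (real n))" "x\<^sub>0 - y \<in> closure (subsums_le (real n))"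
      using y r(2) by (auto simp: subset_iff dist_norm)
    then obtain a b where a: "a \<in> subsums_le (real n)" "dist a (x\<^sub>0 + y) < \<delta>"
        and b: "b \<in> subsums_le (real n)" "dist b (x\<^sub>0 - y) < \<delta>"
      using \<delta> unfolding closure_approachable by blast
    have "y - (1/2) *\<^sub>R (a - b) = (1/2) *\<^sub>R ((b - (x\<^sub>0 - y)) - (a - (x\<^sub>0 + y)))"
      by (simp add: algebra_simps flip: scaleR_2)
    then have "norm (y - (1/2) *\<^sub>R (a - b)) < \<delta>"
      using a(2) b(2) norm_triangle_ineq4[of "b - (x\<^sub>0 - y)" "a - (x\<^sub>0 + y)"]
      by (simp add: dist_norm)
    then show ?thesis
      using subsums_le_half_diff[OF a(1) b(1)] by blast
  qed
  define K where "K = 2 * real n / r"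
  have "\<exists>a\<in>subsums_le (K * norm y). norm (y - a) < \<delta>" if \<delta>: "\<delta> > 0" for y \<delta>
  proof (cases "y = 0")
    case True
    then show ?thesis
      using \<delta> by (intro bexI[of _ 0]) (auto simp: subsums_le_def coord_zero)
  next
    case False
    define t where "t = r / (2 * norm y)"
    have t: "t > 0" using False r(1) by (simp add: t_def)
    have "norm (t *\<^sub>R y) < r"
      using False r(1) by (simp add: t_def)
    then obtain a where a: "a \<in> subsums_le (real n)" "norm (t *\<^sub>R y - a) < t * \<delta>"
      using near0[of "t *\<^sub>R y" "t * \<delta>"] t \<delta> by auto
    have "y - (1/t) *\<^sub>R a = (1/t) *\<^sub>R (t *\<^sub>R y - a)"
      using t by (simp add: scaleR_diff_right)
    also have "norm \<dots> = norm (t *\<^sub>R y - a) / t"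
      using t by simp
    finally have "norm (y - (1/t) *\<^sub>R a) < \<delta>"
      using a(2) t by (simp add: divide_less_eq mult.commute)
    moreover have "(1/t) *\<^sub>R a \<in> subsums_le (K * norm y)"
      using subsums_le_scaleR[OF a(1), of "1/t"] r(1) by (simp add: t_def K_def mult_ac)
    ultimately show ?thesis by blast
  qed
  moreover have "K \<ge> 0" using r(1) by (simp add: K_def)
  ultimately show ?thesis by blast
qed

text \<open>The open mapping argument: \<open>x\<close> is a series of vectors \<open>a k\<close> whose subsums decay
  geometrically in \<open>k\<close>, and adding their coordinates gives the expansion of \<open>x\<close>.\<close>

lemma bounded_subsums:
  "\<exists>K\<ge>0. \<forall>x F. finite F \<longrightarrow> norm (\<Sum>l\<in>F. coord x l) \<le> K * norm x"
proof -
  obtain K where K: "K \<ge> 0"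
    and dense: "\<And>y \<delta>. \<delta> > 0 \<Longrightarrow> \<exists>a\<in>subsums_le (K * norm y). norm (y - a) < \<delta>"
    using subsums_le_dense by auto
  have "norm (\<Sum>l\<in>F. coord x l) \<le> (2 * K) * norm x" if F: "finite F" for x F
  proof (cases "x = 0")
    case True
    then show ?thesis by (simp add: coord_zero)
  next
    case False
    define d where "d = norm x"
    have d: "d > 0" using False by (simp add: d_def)
    define app where "app y \<delta> = (SOME a. a \<in> subsums_le (K * norm y) \<and> norm (y - a) < \<delta>)" for y \<delta>
    have app: "app y \<delta> \<in> subsums_le (K * norm y)" "norm (y - app y \<delta>) < \<delta>" if "\<delta> > 0" for y \<delta>
      using someI_ex[OF dense[OF that, unfolded Bex_def], of y] unfolding app_def by auto
    \<comment> \<open>The remainder after \<open>k\<close> approximations.\<close>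
    define y where "y = rec_nat x (\<lambda>k z. z - app z (d * (1/2)^Suc k))"
    have y0: "y 0 = x" and ySuc: "y (Suc k) = y k - app (y k) (d * (1/2)^Suc k)" for k
      by (simp_all add: y_def)
    define a where "a k = app (y k) (d * (1/2)^Suc k)" for k
    have y_norm: "norm (y k) \<le> d * (1/2)^k" for k
    proof (cases k)
      case 0
      then show ?thesis by (simp add: y0 d_def)
    next
      case (Suc j)
      then show ?thesis
        using app(2)[of "d * (1/2)^Suc j" "y j"] d by (simp add: ySuc less_imp_le)
    qed
    have partial: "(\<Sum>k<m. a k) = x - y m" for m
      by (induction m) (simp_all add: y0 ySuc a_def)
    have a_sub: "norm (\<Sum>l\<in>F. coord (a k) l) \<le> K * d * (1/2)^k" if "finite F" for F k
    proof -
      have "norm (\<Sum>l\<in>F. coord (a k) l) \<le> K * norm (y k)"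
        unfolding a_def using d that by (intro subsums_leD[OF app(1)]) auto
      also have "\<dots> \<le> K * (d * (1/2)^k)"
        using K y_norm by (intro mult_left_mono)
      finally show ?thesis by (simp add: mult.assoc)
    qed
    have geo: "summable (\<lambda>k. K * d * (1/2)^k)"
      by (intro summable_mult summable_geometric) simp
    have coord_a: "summable (\<lambda>k. coord (a k) l)" for l
      using a_sub[of "{l}"] by (intro summable_comparison_test'[OF geo]) simp
    define z where "z l = (\<Sum>k. coord (a k) l)" for l
    have sub_summable: "summable (\<lambda>k. \<Sum>l\<in>F. coord (a k) l)" for F :: "nat set"
      by (intro summable_sum coord_a)
    have z_sum: "(\<Sum>l\<in>F. z l) = (\<Sum>k. \<Sum>l\<in>F. coord (a k) l)" for F
      unfolding z_def by (intro suminf_sum[symmetric] coord_a)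
    have tail: "norm ((\<Sum>l\<in>F. z l) - (\<Sum>l\<in>F. coord (\<Sum>k<m. a k) l)) \<le> 2 * K * d * (1/2)^m"
      if F: "finite F" for F m
    proof -
      have "(\<Sum>l\<in>F. z l) - (\<Sum>l\<in>F. coord (\<Sum>k<m. a k) l) = (\<Sum>k. \<Sum>l\<in>F. coord (a (k + m)) l)"
        using suminf_minus_initial_segment[OF sub_summable[of F], of m]
        by (simp add: z_sum coord_sum sum.swap[of _ F])
      also have "norm \<dots> \<le> (\<Sum>k. K * d * (1/2)^(k + m))"
        by (rule norm_suminf_le[OF a_sub[OF F] summable_ignore_initial_segment[OF geo]])
      also have "\<dots> = (\<Sum>k. (K * d * (1/2)^m) * (1/2)^k)"
        by (simp add: power_add mult_ac)
      also have "\<dots> = 2 * K * d * (1/2)^m"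
        by (subst suminf_mult) (simp_all add: suminf_geometric summable_geometric)
      finally show ?thesis .
    qed
    have "coord x = z"
    proof (rule coord_eqI)
      show "z l \<in> M l" for l
      proof (rule closed_sequentially[OF closed])
        show "(\<lambda>m. \<Sum>k<m. coord (a k) l) \<longlonglongrightarrow> z l"
          unfolding z_def by (rule summable_LIMSEQ[OF coord_a])
        show "(\<Sum>k<m. coord (a k) l) \<in> M l" for m
          by (intro complex_vector.subspace_sum subspace coord_in)
      qed
      show "(z has_sum x) UNIV"
        unfolding has_sum_def
      proof (rule tendstoI)
        fix \<epsilon> :: real assume \<epsilon>: "\<epsilon> > 0"
        have "(\<lambda>m. (2 * K * d + d) * (1/2)^m) \<longlonglongrightarrow> (2 * K * d + d) * 0"
          by (intro tendsto_intros LIMSEQ_power_zero) simp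
        then have "\<forall>\<^sub>F m in sequentially. (2 * K * d + d) * (1/2)^m < \<epsilon> / 2"
          using \<epsilon> by (intro order_tendstoD) auto
        then obtain m where m: "(2 * K * d + d) * (1/2)^m < \<epsilon> / 2"
          using eventually_happens' by (metis sequentially_bot)
        let ?s = "\<Sum>k<m. a k"
        have "\<forall>\<^sub>F F in finite_subsets_at_top UNIV. dist (\<Sum>l\<in>F. coord ?s l) ?s < \<epsilon> / 2"
          using coord_has_sum[of ?s] \<epsilon> unfolding has_sum_def by (intro tendstoD) auto
        moreover have "\<forall>\<^sub>F F in finite_subsets_at_top (UNIV :: nat set). finite F"
          by (rule eventually_finite_subsets_at_top_weakI)
        ultimately show "\<forall>\<^sub>F F in finite_subsets_at_top UNIV. dist (sum z F) x < \<epsilon>"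
        proof eventually_elim
          case (elim F)
          have "norm (?s - x) \<le> d * (1/2)^m"
            using y_norm[of m] by (simp add: partial)
          moreover have "norm ((\<Sum>l\<in>F. z l) - x) \<le> norm ((\<Sum>l\<in>F. z l) - (\<Sum>l\<in>F. coord ?s l)) +
              (norm ((\<Sum>l\<in>F. coord ?s l) - ?s) + norm (?s - x))"
            using norm_triangle_ineq[of "(\<Sum>l\<in>F. z l) - (\<Sum>l\<in>F. coord ?s l)" "(\<Sum>l\<in>F. coord ?s l) - x"]
              norm_triangle_ineq[of "(\<Sum>l\<in>F. coord ?s l) - ?s" "?s - x"] by simp
          ultimately show ?case
            using tail[OF elim(2), of m] elim(1) m by (simp add: dist_norm algebra_simps)
        qed
      qed
    qed
    then show ?thesis
      using tail[OF F, of 0] by (simp add: d_def coord_zero)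
  qed
  then show ?thesis
    using K by (intro exI[of _ "2 * K"]) simp
qed

definition multiplier :: "(nat \<Rightarrow> complex) \<Rightarrow> 'a \<Rightarrow> 'a"
  where "multiplier \<theta> x = infsum (\<lambda>l. \<theta> l *\<^sub>C coord x l) UNIV"

lemma multiplier_has_sum:
  assumes "\<And>l. cmod (\<theta> l) \<le> 1"
  shows "((\<lambda>l. \<theta> l *\<^sub>C coord x l) has_sum multiplier \<theta> x) UNIV"
  unfolding multiplier_def
  by (intro has_sum_infsum summable_on_multiplier has_sum_imp_summable[OF coord_has_sum] assms)

text \<open>The components are subspaces, so the multiplied series is again an expansion, and uniqueness
  identifies it.\<close>

lemma coord_multiplier:
  assumes "\<And>l. cmod (\<theta> l) \<le> 1"
  shows "coord (multiplier \<theta> x) l = \<theta> l *\<^sub>C coord x l"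
  using coord_eqI[OF complex_vector.subspace_scale[OF subspace coord_in] multiplier_has_sum[OF assms]]
  by simp

lemma coord_inject:
  assumes "\<And>l. coord x l = coord y l"
  shows "x = y"
proof -
  have "coord x = coord y" using assms by (rule ext)
  then show ?thesis
    using has_sum_unique[OF coord_has_sum[of x]] coord_has_sum[of y] by simp
qed

lemma multiplier_add:
  "(\<And>l. cmod (\<theta> l) \<le> 1) \<Longrightarrow> multiplier \<theta> (x + y) = multiplier \<theta> x + multiplier \<theta> y"
  by (rule coord_inject) (simp add: coord_multiplier coord_add scaleC_add_right)

lemma multiplier_scaleC:
  "(\<And>l. cmod (\<theta> l) \<le> 1) \<Longrightarrow> multiplier \<theta> (a *\<^sub>C x) = a *\<^sub>C multiplier \<theta> x"
  by (rule coord_inject) (simp add: coord_multiplier coord_scaleC scaleC_scaleC mult.commute)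

lemma multiplier_component:
  assumes "\<And>l. cmod (\<theta> l) \<le> 1" "x \<in> M m"
  shows "multiplier \<theta> x = \<theta> m *\<^sub>C x"
  by (rule coord_inject)
    (simp add: coord_multiplier[OF assms(1)] coord_scaleC coord_component[OF assms(2)])

text \<open>A multiplied subsum is controlled by the subsums of the expansion, and these by the norm.\<close>

lemma uniformly_bounded_multipliers:
  obtains K where "\<And>\<theta> x. (\<And>l. cmod (\<theta> l) \<le> 1) \<Longrightarrow> norm (multiplier \<theta> x) \<le> K * norm x"
proof -
  obtain K where K: "\<And>x F. finite F \<Longrightarrow> norm (\<Sum>l\<in>F. coord x l) \<le> K * norm x"
    using bounded_subsums by auto
  have "norm (multiplier \<theta> x) \<le> (4 * K) * norm x" if \<theta>: "\<And>l. cmod (\<theta> l) \<le> 1" for \<theta> x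
  proof (rule has_sum_norm_le[OF multiplier_has_sum[OF \<theta>]])
    fix F :: "nat set" assume F: "finite F"
    have "norm (\<Sum>l\<in>F. \<theta> l *\<^sub>C coord x l) \<le> 4 * (K * norm x)"
      by (rule norm_complex_multiplier_le[OF F \<theta> K]) (use F finite_subset in auto)
    then show "norm (\<Sum>l\<in>F. \<theta> l *\<^sub>C coord x l) \<le> (4 * K) * norm x" by simp
  qed
  then show ?thesis by (rule that)
qed

lemma bounded_clinear_coord: "bounded_clinear (\<lambda>x. coord x l)"
proof -
  obtain K where K: "\<And>x F. finite F \<Longrightarrow> norm (\<Sum>l\<in>F. coord x l) \<le> K * norm x"
    using bounded_subsums by auto
  show ?thesis
    using K[of "{l}"] by (intro bounded_clinearI[where K = K])
      (simp_all add: coord_add coord_scaleC mult.commute)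
qed

end

section \<open>Unimodular numbers with small powers along a non-Jamison sequence\<close>

text \<open>The operators that witness the failure of the Jamison property live on spaces given by a
  carrier set, so some vector calculus is needed there first.\<close>

context complex_banach_space
begin

lemma scale_zero: "x \<in> vecs Y \<Longrightarrow> vscale Y 0 x = vzero Y"
  using scale_add_left[of x 1 "- 1"] by (simp add: scale_one add_minus)

lemma scale_zero_right: "vscale Y a (vzero Y) = vzero Y"
  using scale_scale[OF zero_closed, of a 0] by (simp add: scale_zero zero_closed)

lemma norm_zero: "vnorm Y (vzero Y) = 0"
  by (simp add: norm_zero_iff zero_closed)

lemma add_swap:
  assumes "a \<in> vecs Y" "b \<in> vecs Y" "c \<in> vecs Y" "d \<in> vecs Y"
  shows "vadd Y (vadd Y a b) (vadd Y c d) = vadd Y (vadd Y a c) (vadd Y b d)"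
proof -
  have "vadd Y b (vadd Y c d) = vadd Y c (vadd Y b d)"
    using assms add_assoc[of b c d] add_assoc[of c b d] add_commute[of b c] by simp
  then show ?thesis
    using assms by (simp add: add_assoc add_closed)
qed

context
  fixes T assumes T: "T \<in> bounded_operators_on Y"
begin

lemma T_closed: "x \<in> vecs Y \<Longrightarrow> T x \<in> vecs Y"
  and T_add: "x \<in> vecs Y \<Longrightarrow> y \<in> vecs Y \<Longrightarrow> T (vadd Y x y) = vadd Y (T x) (T y)"
  and T_scale: "x \<in> vecs Y \<Longrightarrow> T (vscale Y a x) = vscale Y a (T x)"
  using T by (auto simp: bounded_operators_on_def)

lemma T_pow_closed: "x \<in> vecs Y \<Longrightarrow> (T ^^ m) x \<in> vecs Y"
  by (induction m) (auto intro: T_closed)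

lemma T_pow_add:
  "x \<in> vecs Y \<Longrightarrow> y \<in> vecs Y \<Longrightarrow> (T ^^ m) (vadd Y x y) = vadd Y ((T ^^ m) x) ((T ^^ m) y)"
  by (induction m) (auto simp: T_pow_closed T_add)

lemma T_pow_scale: "x \<in> vecs Y \<Longrightarrow> (T ^^ m) (vscale Y a x) = vscale Y a ((T ^^ m) x)"
  by (induction m) (auto simp: T_pow_closed T_scale)

lemma T_pow_bounded: "\<exists>K\<ge>0. \<forall>x\<in>vecs Y. vnorm Y ((T ^^ m) x) \<le> K * vnorm Y x"
proof -
  obtain K where K: "\<forall>x\<in>vecs Y. vnorm Y (T x) \<le> vnorm Y x * K"
    using T unfolding bounded_operators_on_def by blast
  have K': "vnorm Y (T x) \<le> \<bar>K\<bar> * vnorm Y x" if "x \<in> vecs Y" for x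
    using bspec[OF K that] mult_right_mono[OF abs_ge_self[of K] norm_nonneg[OF that]]
    by (simp add: mult.commute)
  have "vnorm Y ((T ^^ m) x) \<le> \<bar>K\<bar> ^ m * vnorm Y x" if "x \<in> vecs Y" for x
  proof (induction m)
    case (Suc m)
    have "vnorm Y ((T ^^ Suc m) x) \<le> \<bar>K\<bar> * vnorm Y ((T ^^ m) x)"
      using K'[OF T_pow_closed[OF that]] by simp
    also have "\<dots> \<le> \<bar>K\<bar> * (\<bar>K\<bar> ^ m * vnorm Y x)"
      by (rule mult_left_mono[OF Suc]) simp
    finally show ?case by (simp add: mult.assoc)
  qed simp
  then show ?thesis by (intro exI[of _ "\<bar>K\<bar> ^ m"]) simp
qed

lemma norm_T_pow_le_opnorm:
  assumes x: "x \<in> vecs Y"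
  shows "vnorm Y ((T ^^ m) x) \<le> opnorm_on Y (T ^^ m) * vnorm Y x"
proof -
  obtain K where K: "K \<ge> 0" "\<And>x. x \<in> vecs Y \<Longrightarrow> vnorm Y ((T ^^ m) x) \<le> K * vnorm Y x"
    using T_pow_bounded by blast
  have "vnorm Y ((T ^^ m) z) / vnorm Y z \<le> K" if "z \<in> vecs Y" for z
    using K(1) K(2)[OF that] norm_nonneg[OF that]
    by (cases "vnorm Y z = 0") (auto simp: divide_le_eq)
  then have "bdd_above ((\<lambda>z. vnorm Y ((T ^^ m) z) / vnorm Y z) ` vecs Y)"
    by (auto intro!: bdd_aboveI[where M = K])
  then have le: "vnorm Y ((T ^^ m) x) / vnorm Y x \<le> opnorm_on Y (T ^^ m)"
    unfolding opnorm_on_def using x by (rule cSUP_upper2) simp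
  show ?thesis
  proof (cases "vnorm Y x = 0")
    case True
    then show ?thesis using K(2)[OF x] by simp
  next
    case False
    then have "vnorm Y x > 0" using norm_nonneg[OF x] by simp
    then show ?thesis using le by (simp add: divide_le_eq)
  qed
qed

lemma unit_eigenvector:
  assumes "\<mu> \<in> point_spectrum_on Y T"
  shows "\<exists>e\<in>vecs Y. vnorm Y e = 1 \<and> T e = vscale Y \<mu> e"
proof -
  have "T (vzero Y) = vzero Y"
    using T_scale[OF zero_closed, of 0] by (simp add: scale_zero zero_closed T_closed)
  then have "vadd Y (T (vzero Y)) (vscale Y (-1) (vscale Y \<mu> (vzero Y))) = vzero Y"
    by (simp add: scale_zero_right add_zero zero_closed)
  then obtain x where x: "x \<in> vecs Y" "x \<noteq> vzero Y"
      and eq: "vadd Y (T x) (vscale Y (-1) (vscale Y \<mu> x)) = vzero Y"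
    using assms zero_closed unfolding point_spectrum_on_def by auto
  have Tx: "T x = vscale Y \<mu> x"
    by (rule diff_eq_zeroD[OF T_closed[OF x(1)] scale_closed[OF x(1)] eq])
  define a where "a = complex_of_real (1 / vnorm Y x)"
  have "vnorm Y x > 0"
    using x norm_zero_iff[OF x(1)] norm_nonneg[OF x(1)] by simp
  then have "vnorm Y (vscale Y a x) = 1"
    by (simp add: norm_scale x(1) a_def norm_divide)
  moreover have "T (vscale Y a x) = vscale Y \<mu> (vscale Y a x)"
    by (simp add: T_scale Tx x(1) scale_scale mult.commute)
  ultimately show ?thesis
    using scale_closed[OF x(1)] by blast
qed

text \<open>With \<open>w = e - f\<close>, the vector \<open>(\<rho> ^ m - \<mu> ^ m) e\<close> equals \<open>(T ^^ m) w - \<mu> ^ m w\<close>.\<close>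

lemma eigenvalue_powers_close:
  assumes e: "e \<in> vecs Y" "vnorm Y e = 1" "T e = vscale Y \<rho> e"
    and f: "f \<in> vecs Y" "T f = vscale Y \<mu> f" and \<mu>: "cmod \<mu> = 1"
    and K: "\<And>x. x \<in> vecs Y \<Longrightarrow> vnorm Y ((T ^^ m) x) \<le> K * vnorm Y x"
  shows "cmod (\<rho> ^ m - \<mu> ^ m) \<le> (K + 1) * vdist Y e f"
proof -
  have eigen_pow: "(T ^^ m) x = vscale Y (\<kappa> ^ m) x" if "x \<in> vecs Y" "T x = vscale Y \<kappa> x" for x \<kappa>
    by (induction m) (simp_all add: that scale_one T_scale scale_scale mult.commute)
  define w where "w = vadd Y e (vscale Y (-1) f)"
  have w: "w \<in> vecs Y" and dist: "vdist Y e f = vnorm Y w"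
    using e f by (auto simp: w_def vdist_def add_closed scale_closed)
  have Tw: "(T ^^ m) w = vadd Y (vscale Y (\<rho> ^ m) e) (vscale Y (- (\<mu> ^ m)) f)"
    using e(1,3) f by (simp add: w_def T_pow_add T_pow_scale scale_closed eigen_pow scale_scale)
  have \<mu>w: "vscale Y (- (\<mu> ^ m)) w = vadd Y (vscale Y (- (\<mu> ^ m)) e) (vscale Y (\<mu> ^ m) f)"
    using e(1) f(1) by (simp add: w_def scale_add_right scale_closed scale_scale)
  have "vscale Y (\<rho> ^ m - \<mu> ^ m) e = vadd Y ((T ^^ m) w) (vscale Y (- (\<mu> ^ m)) w)"
    unfolding Tw \<mu>w using e(1) f(1)
    by (simp add: add_swap scale_closed scale_zero add_zero flip: scale_add_left)
  then have "vnorm Y (vscale Y (\<rho> ^ m - \<mu> ^ m) e) \<le> K * vnorm Y w + vnorm Y w"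
    using norm_triangle[OF T_pow_closed[OF w, of m] scale_closed[OF w, of "- (\<mu> ^ m)"]] K[OF w]
    by (simp add: norm_scale w norm_power \<mu>)
  then show ?thesis
    by (simp add: norm_scale e dist algebra_simps)
qed

text \<open>If distinct eigenvalues were uniformly separated along \<open>n\<close>, unit eigenvectors would be
  uniformly separated too, and a separable space contains only countably many such vectors.\<close>

lemma close_eigenvalues:
  assumes sep: "separable_cspace Y" and pb: "partially_power_bounded_on Y n T"
    and unc: "uncountable (point_spectrum_on Y T \<inter> unit_circle)" and \<epsilon>: "\<epsilon> > 0"
  obtains \<rho> \<mu> where "cmod \<rho> = 1" "cmod \<mu> = 1" "\<rho> \<noteq> \<mu>"
    "\<And>m. m \<in> insert 1 (range n) \<Longrightarrow> cmod (\<rho> ^ m - \<mu> ^ m) \<le> \<epsilon>"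
proof -
  define \<Lambda> where "\<Lambda> = point_spectrum_on Y T \<inter> unit_circle"
  have circle: "cmod \<rho> = 1" if "\<rho> \<in> \<Lambda>" for \<rho>
    using that by (simp add: \<Lambda>_def unit_circle_def)
  obtain B where B: "\<And>k. opnorm_on Y (T ^^ n k) \<le> B"
    using pb by (auto simp: partially_power_bounded_on_def bdd_above_def)
  define K where "K = max (max 0 B) (opnorm_on Y (T ^^ 1))"
  have K: "vnorm Y ((T ^^ m) x) \<le> K * vnorm Y x"
    if "m \<in> insert 1 (range n)" "x \<in> vecs Y" for m x
  proof -
    have "opnorm_on Y (T ^^ m) \<le> K"
      using that(1) B by (auto simp: K_def le_max_iff_disj)
    then show ?thesis
      by (rule order_trans[OF norm_T_pow_le_opnorm[OF that(2)] mult_right_mono])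
        (rule norm_nonneg[OF that(2)])
  qed
  have K0: "K \<ge> 0" by (simp add: K_def)
  obtain e where e: "\<And>\<rho>. \<rho> \<in> \<Lambda> \<Longrightarrow> e \<rho> \<in> vecs Y \<and> vnorm Y (e \<rho>) = 1 \<and> T (e \<rho>) = vscale Y \<rho> (e \<rho>)"
    using unit_eigenvector unfolding \<Lambda>_def by (metis IntD1)
  obtain C where C: "countable C" "C \<subseteq> vecs Y"
      and dense: "\<forall>x\<in>vecs Y. \<forall>r>0. \<exists>c\<in>C. vdist Y x c < r"
    using sep unfolding separable_cspace_iff by blast
  define \<delta> where "\<delta> = \<epsilon> / (K + 1)"
  have \<delta>: "\<delta> > 0" using \<epsilon> K0 by (simp add: \<delta>_def)
  have "\<exists>c\<in>C. vdist Y (e \<rho>) c < \<delta> / 2" if "\<rho> \<in> \<Lambda>" for \<rho>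
    using dense[rule_format, of "e \<rho>" "\<delta> / 2"] e[OF that] \<delta> by simp
  then obtain g where g: "\<And>\<rho>. \<rho> \<in> \<Lambda> \<Longrightarrow> g \<rho> \<in> C \<and> vdist Y (e \<rho>) (g \<rho>) < \<delta> / 2"
    by metis
  have "\<not> inj_on g \<Lambda>"
  proof
    assume "inj_on g \<Lambda>"
    moreover have "countable (g ` \<Lambda>)"
      using g by (intro countable_subset[OF _ C(1)]) auto
    ultimately have "countable \<Lambda>"
      using countable_image_inj_on by blast
    then show False using unc by (simp add: \<Lambda>_def)
  qed
  then obtain \<rho> \<mu> where \<Lambda>: "\<rho> \<in> \<Lambda>" "\<mu> \<in> \<Lambda>" and ne: "\<rho> \<noteq> \<mu>" and eq: "g \<rho> = g \<mu>"
    unfolding inj_on_def by blast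
  have "vdist Y (e \<rho>) (e \<mu>) \<le> vdist Y (e \<rho>) (g \<rho>) + vdist Y (g \<rho>) (e \<mu>)"
    using e[OF \<Lambda>(1)] e[OF \<Lambda>(2)] g[OF \<Lambda>(1)] C(2) by (intro triangle) auto
  also have "\<dots> \<le> \<delta>"
    using g[OF \<Lambda>(1)] g[OF \<Lambda>(2)] by (simp add: eq commute[of "g \<mu>"])
  finally have d: "vdist Y (e \<rho>) (e \<mu>) \<le> \<delta>" .
  have "cmod (\<rho> ^ m - \<mu> ^ m) \<le> \<epsilon>" if m: "m \<in> insert 1 (range n)" for m
  proof -
    have "cmod (\<rho> ^ m - \<mu> ^ m) \<le> (K + 1) * vdist Y (e \<rho>) (e \<mu>)"
      using e[OF \<Lambda>(1)] e[OF \<Lambda>(2)] circle[OF \<Lambda>(2)] K[OF m]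
      by (intro eigenvalue_powers_close) auto
    also have "\<dots> \<le> (K + 1) * \<delta>"
      using d K0 by (intro mult_left_mono) auto
    also have "\<dots> = \<epsilon>" using K0 by (simp add: \<delta>_def)
    finally show ?thesis .
  qed
  then show ?thesis
    using circle[OF \<Lambda>(1)] circle[OF \<Lambda>(2)] ne by (intro that)
qed

end

end

text \<open>Take \<open>\<nu>\<close> to be the quotient of two close eigenvalues.  The exponent \<open>1\<close> can be
  included because the operator is itself bounded; it guarantees that \<open>\<nu>\<close> is close to \<open>1\<close>, whatever
  the common divisors of the exponents are.\<close>

lemma not_jamison_imp_small_powers:
  assumes "\<not> jamison_sequence n" "\<epsilon> > 0"
  shows "\<exists>\<nu>. cmod \<nu> = 1 \<and> \<nu> \<noteq> 1 \<and> (\<forall>m\<in>insert 1 (range n). cmod (\<nu> ^ m - 1) \<le> \<epsilon>)"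
proof -
  obtain Y :: "nat set cspace" and T where "complex_banach_space Y"
      and Y: "separable_cspace Y" "T \<in> bounded_operators_on Y" "partially_power_bounded_on Y n T"
        "uncountable (point_spectrum_on Y T \<inter> unit_circle)"
    using assms(1) unfolding jamison_sequence_def by blast
  interpret complex_banach_space Y by fact
  obtain \<rho> \<mu> where \<rho>: "cmod \<rho> = 1" and \<mu>: "cmod \<mu> = 1" and ne: "\<rho> \<noteq> \<mu>"
      and close: "\<And>m. m \<in> insert 1 (range n) \<Longrightarrow> cmod (\<rho> ^ m - \<mu> ^ m) \<le> \<epsilon>"
    using close_eigenvalues[OF Y(2,1,3,4) assms(2)] by metis
  have \<mu>0: "\<mu> \<noteq> 0" using \<mu> by auto
  have "cmod ((\<rho> / \<mu>) ^ m - 1) = cmod (\<rho> ^ m - \<mu> ^ m)" for m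
  proof -
    have "(\<rho> / \<mu>) ^ m - 1 = (\<rho> ^ m - \<mu> ^ m) / \<mu> ^ m"
      using \<mu>0 by (simp add: power_divide diff_divide_distrib)
    then show ?thesis by (simp add: norm_divide norm_power \<mu>)
  qed
  then show ?thesis
    using close \<rho> \<mu> \<mu>0 ne by (intro exI[of _ "\<rho> / \<mu>"]) (simp add: norm_divide)
qed

section \<open>An operator with a Cantor set of unimodular eigenvalues\<close>

lemma nuclear_series:
  fixes \<phi> :: "nat \<Rightarrow> 'a::complex_banach \<Rightarrow> complex" and w :: "nat \<Rightarrow> 'a"
  assumes \<phi>: "\<And>l. bounded_clinear (\<phi> l)"
    and bound: "\<And>l x. cmod (\<phi> l x) * norm (w l) \<le> b * norm x * (1/2)^l"
  shows "summable (\<lambda>l. \<phi> l x *\<^sub>C w l)"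
    and "bounded_clinear (\<lambda>x. \<Sum>l. \<phi> l x *\<^sub>C w l)"
    and "norm (\<Sum>l. \<phi> l x *\<^sub>C w l) \<le> 2 * b * norm x"
proof -
  have geo: "summable (\<lambda>l. b * norm x * (1/2)^l)" for x :: 'a
    by (intro summable_mult summable_geometric) simp
  have le: "norm (\<phi> l x *\<^sub>C w l) \<le> b * norm x * (1/2)^l" for l x
    using bound by (simp add: norm_scaleC)
  show sm: "summable (\<lambda>l. \<phi> l x *\<^sub>C w l)" for x
    by (rule summable_comparison_test'[OF geo le])
  have "norm (\<Sum>l. \<phi> l x *\<^sub>C w l) \<le> (\<Sum>l. b * norm x * (1/2)^l)" for x
    by (rule norm_suminf_le[OF le geo])
  also have "(\<Sum>l. b * norm x * (1/2)^l) = 2 * b * norm x" for x :: 'a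
    by (subst suminf_mult) (simp_all add: suminf_geometric summable_geometric)
  finally show norm: "norm (\<Sum>l. \<phi> l x *\<^sub>C w l) \<le> 2 * b * norm x" for x .
  show "bounded_clinear (\<lambda>x. \<Sum>l. \<phi> l x *\<^sub>C w l)"
  proof (rule bounded_clinearI[where K = "2 * b"])
    show "(\<Sum>l. \<phi> l (x + y) *\<^sub>C w l) = (\<Sum>l. \<phi> l x *\<^sub>C w l) + (\<Sum>l. \<phi> l y *\<^sub>C w l)" for x y
      by (simp add: bounded_clinearD(3)[OF \<phi>] scaleC_add_left suminf_add sm)
    show "(\<Sum>l. \<phi> l (a *\<^sub>C x) *\<^sub>C w l) = a *\<^sub>C (\<Sum>l. \<phi> l x *\<^sub>C w l)" for a x
      using bounded_linear.suminf[OF bounded_clinearD(1)[OF bounded_clinear_scaleC] sm, of a x]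
      by (simp add: bounded_clinearD(2)[OF \<phi>] scaleC_complex_def scaleC_scaleC)
  qed (use norm in \<open>simp add: mult_ac\<close>)
qed

lemma convergent_geometric_increments:
  fixes f :: "nat \<Rightarrow> 'b::banach"
  assumes "\<And>k. norm (f (Suc k) - f k) \<le> c * r ^ k" "\<bar>r\<bar> < 1"
  shows "convergent f"
proof -
  have "summable (\<lambda>k. c * r ^ k)"
    using assms(2) by (intro summable_mult summable_geometric) simp
  then have "summable (\<lambda>k. f (Suc k) - f k)"
    using assms(1) by (rule summable_comparison_test')
  then have "convergent (\<lambda>n. f n - f 0)"
    by (simp add: summable_iff_convergent sum_lessThan_telescope)
  then show ?thesis
    using convergent_add[OF _ convergent_const[of "f 0"]] by fastforce
qed

text \<open>The indices form a binary tree in heap order: the parent of \<open>l\<close> is \<open>l div 2\<close>, with \<open>0\<close> as the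
  root and \<open>1\<close> as its only child.  The vector at \<open>l\<close> is the sum of the \<open>(1/2) ^ i e i\<close> along the path
  from the root, hence it converges along every branch.\<close>

fun tree_vector :: "(nat \<Rightarrow> 'a) \<Rightarrow> nat \<Rightarrow> 'a::complex_banach"
  where "tree_vector e l = (if l = 0 then e 0 else tree_vector e (l div 2) + (1/2)^l *\<^sub>C e l)"

declare tree_vector.simps [simp del]

text \<open>The vectors \<open>tree_vector e l\<close> will be eigenvectors.  They do not depend on the eigenvalues, so
  each \<open>\<nu> l\<close> can be chosen afterwards, as close to \<open>1\<close> as the last assumption demands: there,
  \<open>(1/4) ^ l\<close> pays for the factor \<open>2 ^ l\<close> that occurs in \<open>w\<close> below and still leaves the summable
  \<open>(1/2) ^ l\<close>.  The decay of \<open>\<nu> l - 1\<close> keeps the eigenvalues of different branches apart.\<close>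

locale eigenvalue_tree = unconditional_decomposition M for M :: "nat \<Rightarrow> 'a::complex_banach set" +
  fixes e :: "nat \<Rightarrow> 'a" and \<psi> :: "nat \<Rightarrow> 'a \<Rightarrow> complex" and \<nu> :: "nat \<Rightarrow> complex"
    and S :: "nat set" and B :: "nat \<Rightarrow> real"
  assumes e_in: "e l \<in> M l" and e_norm: "norm (e l) = 1"
    and \<psi>: "bounded_clinear (\<psi> l)" and \<psi>_e: "\<psi> l (e l) = 1"
    and B: "cmod (\<psi> l (coord x l)) \<le> B l * norm x"
    and \<nu>_norm: "cmod (\<nu> l) = 1" and \<nu>_ne: "\<nu> l \<noteq> 1"
    and \<nu>_decay: "4 * cmod (\<nu> (Suc l) - 1) \<le> cmod (\<nu> l - 1)"
    and \<nu>_S: "m \<in> insert 1 S \<Longrightarrow> cmod (\<nu> l ^ m - 1) * (B l * norm (tree_vector e (l div 2))) \<le> (1/4)^l"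
begin

abbreviation u :: "nat \<Rightarrow> 'a"
  where "u \<equiv> tree_vector e"

lemma u_0: "u 0 = e 0"
  and u_step: "l > 0 \<Longrightarrow> u l = u (l div 2) + (1/2)^l *\<^sub>C e l"
  by (simp_all add: tree_vector.simps[of e l] tree_vector.simps[of e 0])

definition \<phi> :: "nat \<Rightarrow> 'a \<Rightarrow> complex"
  where "\<phi> l x = \<psi> l (coord x l)"

lemma bounded_clinear_\<phi>: "bounded_clinear (\<phi> l)"
  using \<psi>[of l] bounded_clinear_coord[of l] unfolding \<phi>_def bounded_clinear_def
  by (auto intro: bounded_linear_compose[of "\<psi> l"])

lemma \<phi>_e: "\<phi> l (e m) = (if l = m then 1 else 0)"
  using bounded_clinearD(5)[OF \<psi>] by (simp add: \<phi>_def coord_component[OF e_in] \<psi>_e)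

lemma \<phi>_u_0: "\<phi> 0 (u l) = 1"
proof (induction l rule: less_induct)
  case (less l)
  then show ?case
    by (cases "l = 0")
      (simp_all add: u_0 u_step \<phi>_e bounded_clinearD(2,3)[OF bounded_clinear_\<phi>] scaleC_complex_def)
qed

text \<open>The eigenvalue at \<open>l\<close>: a left child inherits that of its parent, a right child turns it by
  \<open>\<nu> l\<close>.\<close>

fun ev :: "nat \<Rightarrow> complex"
  where "ev l = (if l = 0 then 1 else ev (l div 2) * (if odd l then \<nu> l else 1))"

declare ev.simps [simp del]

lemma ev_0: "ev 0 = 1"
  by (simp add: ev.simps)

lemma ev_norm: "cmod (ev l) = 1"
proof (induction l rule: less_induct)
  case (less l)
  then show ?case
    by (cases "l = 0") (simp_all add: ev_0 ev.simps[of l] norm_mult \<nu>_norm)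
qed

lemma ev_power_le_1: "cmod (ev l ^ n) \<le> 1"
  by (simp add: norm_power ev_norm)

lemma ev_diff: "cmod (ev l ^ n - ev (l div 2) ^ n) \<le> cmod (\<nu> l ^ n - 1)"
proof (cases "l > 0 \<and> odd l")
  case True
  then have "ev l ^ n - ev (l div 2) ^ n = ev (l div 2) ^ n * (\<nu> l ^ n - 1)"
    by (simp add: ev.simps[of l] power_mult_distrib algebra_simps)
  then show ?thesis by (simp add: norm_mult norm_power ev_norm)
next
  case False
  then have "ev l = ev (l div 2)"
    by (cases "l = 0") (simp_all add: ev.simps[of l] ev_0)
  then show ?thesis by simp
qed

definition w :: "nat \<Rightarrow> nat \<Rightarrow> 'a"
  where "w n l = ((ev l ^ n - ev (l div 2) ^ n) * 2^l) *\<^sub>C u (l div 2)"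

text \<open>\<open>A 1\<close> is the operator of the theorem, a diagonal operator plus a nuclear one, and \<open>A n\<close> is a
  closed form of its \<open>n\<close>-th power.  Its nuclear part is governed by the differences
  \<open>ev l ^ n - ev (l div 2) ^ n\<close>, which are small for all exponents \<open>n \<in> S\<close> at once.\<close>

definition A :: "nat \<Rightarrow> 'a \<Rightarrow> 'a"
  where "A n x = multiplier (\<lambda>l. ev l ^ n) x + (\<Sum>l. \<phi> l x *\<^sub>C w n l)"

lemma \<phi>_w_bound:
  assumes "cmod (\<nu> l ^ n - 1) * (B l * norm (u (l div 2))) \<le> b * (1/4)^l"
  shows "cmod (\<phi> l x) * norm (w n l) \<le> b * norm x * (1/2)^l"
proof -
  have B0: "B l \<ge> 0"
    using order_trans[OF norm_ge_zero B[of l "e l"]] by (simp add: e_norm)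
  have "cmod (\<phi> l x) * norm (w n l) \<le>
      (B l * norm x) * (cmod (\<nu> l ^ n - 1) * 2^l * norm (u (l div 2)))"
    using B[of l x] ev_diff[of l n] B0 unfolding w_def \<phi>_def norm_scaleC norm_mult norm_power
    by (intro mult_mono mult_right_mono) auto
  also have "\<dots> = (cmod (\<nu> l ^ n - 1) * (B l * norm (u (l div 2)))) * (norm x * 2^l)"
    by (simp add: mult_ac)
  also have "\<dots> \<le> (b * (1/4)^l) * (norm x * 2^l)"
    using assms by (intro mult_right_mono) auto
  also have "\<dots> = b * norm x * ((1/4) * 2)^l"
    unfolding power_mult_distrib by (simp add: mult_ac)
  finally show ?thesis by simp
qed

text \<open>For an arbitrary exponent the numbers \<open>\<nu> l ^ n\<close> are at most \<open>n\<close> times further from \<open>1\<close> than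
  \<open>\<nu> l\<close>; this is enough for the series to converge.\<close>

lemma \<phi>_w_bound_n: "cmod (\<phi> l x) * norm (w n l) \<le> real n * norm x * (1/2)^l"
proof (rule \<phi>_w_bound)
  have "cmod (\<nu> l ^ n - 1) \<le> real n * cmod (\<nu> l - 1)"
    using norm_power_diff[of "\<nu> l" 1 n] by (simp add: \<nu>_norm)
  moreover have "B l * norm (u (l div 2)) \<ge> 0"
    using order_trans[OF norm_ge_zero B[of l "e l"]] by (simp add: e_norm)
  ultimately have "cmod (\<nu> l ^ n - 1) * (B l * norm (u (l div 2)))
      \<le> (real n * cmod (\<nu> l - 1)) * (B l * norm (u (l div 2)))"
    by (rule mult_right_mono)
  also have "\<dots> = real n * (cmod (\<nu> l ^ 1 - 1) * (B l * norm (u (l div 2))))"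
    by simp
  also have "\<dots> \<le> real n * (1/4)^l"
    by (intro mult_left_mono \<nu>_S) auto
  finally show "cmod (\<nu> l ^ n - 1) * (B l * norm (u (l div 2))) \<le> real n * (1/4)^l" .
qed

lemmas series = nuclear_series[of \<phi>, OF bounded_clinear_\<phi> \<phi>_w_bound_n]

lemma bounded_clinear_A: "bounded_clinear (A n)"
proof -
  obtain K where K: "\<And>\<theta> x. (\<And>l. cmod (\<theta> l) \<le> 1) \<Longrightarrow> norm (multiplier \<theta> x) \<le> K * norm x"
    using uniformly_bounded_multipliers by blast
  show ?thesis
  proof (rule bounded_clinearI[where K = "K + 2 * real n"])
    show "A n (x + y) = A n x + A n y" for x y
      by (simp add: A_def multiplier_add[OF ev_power_le_1] bounded_clinearD(3)[OF series(2)])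
    show "A n (a *\<^sub>C x) = a *\<^sub>C A n x" for a x
      by (simp add: A_def multiplier_scaleC[OF ev_power_le_1] bounded_clinearD(2)[OF series(2)]
          scaleC_add_right)
    show "norm (A n x) \<le> norm x * (K + 2 * real n)" for x
      using norm_triangle_ineq[of "multiplier (\<lambda>l. ev l ^ n) x" "\<Sum>l. \<phi> l x *\<^sub>C w n l"]
        K[of "\<lambda>l. ev l ^ n" x, OF ev_power_le_1] series(3)[of x n]
      by (simp add: A_def algebra_simps)
  qed
qed

lemma A_bounded_on_S: "\<exists>K. \<forall>n\<in>S. \<forall>x. norm (A n x) \<le> K * norm x"
proof -
  obtain K where K: "\<And>\<theta> x. (\<And>l. cmod (\<theta> l) \<le> 1) \<Longrightarrow> norm (multiplier \<theta> x) \<le> K * norm x"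
    using uniformly_bounded_multipliers by blast
  have "norm (A n x) \<le> (K + 2) * norm x" if n: "n \<in> S" for n x
  proof -
    have "cmod (\<phi> l x) * norm (w n l) \<le> 1 * norm x * (1/2)^l" for l x
      using \<nu>_S[of n l] n by (intro \<phi>_w_bound) simp
    note nuclear_series(3)[of \<phi>, OF bounded_clinear_\<phi> this, of x]
    then show ?thesis
      using norm_triangle_ineq[of "multiplier (\<lambda>l. ev l ^ n) x" "\<Sum>l. \<phi> l x *\<^sub>C w n l"]
        K[of "\<lambda>l. ev l ^ n" x, OF ev_power_le_1]
      by (simp add: A_def algebra_simps)
  qed
  then show ?thesis by blast
qed

lemma A_e: "A n (e l) = ev l ^ n *\<^sub>C e l + w n l"
proof -
  have "(\<Sum>k. \<phi> k (e l) *\<^sub>C w n k) = (\<Sum>k\<in>{l}. \<phi> k (e l) *\<^sub>C w n k)"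
    by (rule suminf_finite) (auto simp: \<phi>_e)
  then show ?thesis
    by (simp add: A_def multiplier_component[OF ev_power_le_1 e_in] \<phi>_e)
qed

text \<open>The perturbation was designed for this: the vector \<open>w n l\<close> is what the difference quotient
  \<open>(u l - u (l div 2)) / (1/2)^l = e l\<close> of the eigenvectors requires.\<close>

lemma A_u: "A n (u l) = ev l ^ n *\<^sub>C u l"
proof (induction l rule: less_induct)
  case (less l)
  show ?case
  proof (cases "l = 0")
    case True
    then show ?thesis by (simp add: u_0 A_e w_def ev_0)
  next
    case False
    have "(1/2)^l *\<^sub>C w n l = (ev l ^ n - ev (l div 2) ^ n) *\<^sub>C u (l div 2)"
      by (simp add: w_def scaleC_scaleC power_divide)
    then show ?thesis
      using False less.IH[of "l div 2"]
      by (simp add: u_step bounded_clinearD(2,3)[OF bounded_clinear_A] A_e scaleC_add_right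
          scaleC_scaleC mult.commute complex_vector.scale_left_diff_distrib)
  qed
qed

lemma A_0: "A 0 x = x"
  by (simp add: A_def w_def, rule coord_inject) (simp add: coord_multiplier)

text \<open>On the term with index \<open>l\<close>, and with \<open>a = ev l\<close>, \<open>b = ev (l div 2)\<close>, the diagonal part of
  \<open>A n\<close> contributes \<open>a ^ n (a - b)\<close> and its nuclear part \<open>b (a ^ n - b ^ n)\<close>; together these give
  \<open>a ^ Suc n - b ^ Suc n\<close>.\<close>

lemma A_Suc: "A 1 (A n x) = A (Suc n) x"
proof -
  let ?D = "\<lambda>n. multiplier (\<lambda>l. ev l ^ n)"
  have D: "?D 1 (?D n x) = ?D (Suc n) x"
    by (rule coord_inject) (simp add: coord_multiplier ev_power_le_1 ev_norm norm_mult norm_power scaleC_scaleC)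
  have \<phi>D: "\<phi> l (?D n x) = ev l ^ n * \<phi> l x" for l
    by (simp add: \<phi>_def coord_multiplier ev_power_le_1 bounded_clinearD(2)[OF \<psi>] scaleC_complex_def)
  have Aw: "A 1 (w n l) = ev (l div 2) *\<^sub>C w n l" for l
    using A_u[of 1 "l div 2"]
    by (simp add: w_def bounded_clinearD(2)[OF bounded_clinear_A] scaleC_scaleC mult_ac)
  have term_eq: "\<phi> l (?D n x) *\<^sub>C w 1 l + A 1 (\<phi> l x *\<^sub>C w n l) = \<phi> l x *\<^sub>C w (Suc n) l" for l
    unfolding \<phi>D bounded_clinearD(2)[OF bounded_clinear_A] Aw
    by (simp add: w_def scaleC_scaleC algebra_simps flip: scaleC_add_left)
  have "A 1 (A n x) = A 1 (?D n x) + A 1 (\<Sum>l. \<phi> l x *\<^sub>C w n l)"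
    by (simp add: A_def[of n] bounded_clinearD(3)[OF bounded_clinear_A])
  also have "A 1 (\<Sum>l. \<phi> l x *\<^sub>C w n l) = (\<Sum>l. A 1 (\<phi> l x *\<^sub>C w n l))"
    by (rule bounded_linear.suminf[OF bounded_clinearD(1)[OF bounded_clinear_A] series(1)])
  also have "A 1 (?D n x) = ?D (Suc n) x + (\<Sum>l. \<phi> l (?D n x) *\<^sub>C w 1 l)"
    unfolding A_def[of 1] D ..
  also have "?D (Suc n) x + (\<Sum>l. \<phi> l (?D n x) *\<^sub>C w 1 l) + (\<Sum>l. A 1 (\<phi> l x *\<^sub>C w n l)) =
      ?D (Suc n) x + (\<Sum>l. \<phi> l (?D n x) *\<^sub>C w 1 l + A 1 (\<phi> l x *\<^sub>C w n l))"
    by (simp add: add.assoc suminf_add[OF series(1)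
          bounded_linear.summable[OF bounded_clinearD(1)[OF bounded_clinear_A] series(1)]])
  also have "\<dots> = A (Suc n) x"
    by (simp only: term_eq A_def[of "Suc n"])
  finally show ?thesis .
qed

lemma A_power: "A 1 ^^ n = A n"
  by (induction n) (auto simp: A_0 A_Suc[simplified] fun_eq_iff)

text \<open>The branch \<open>\<sigma>\<close> starts at \<open>1\<close> since the root has only one proper child.\<close>

primrec node :: "(nat \<Rightarrow> bool) \<Rightarrow> nat \<Rightarrow> nat"
  where "node \<sigma> 0 = 1"
  | "node \<sigma> (Suc k) = 2 * node \<sigma> k + (if \<sigma> k then 1 else 0)"

lemma node_Suc_div: "node \<sigma> (Suc k) div 2 = node \<sigma> k"
  by simp

lemma node_gt: "k < node \<sigma> k"
  by (induction k) auto

lemma node_less_Suc: "node \<sigma> k < node \<sigma> (Suc k)"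
  using node_gt[of k \<sigma>] by simp

lemma node_cong: "(\<And>i. i < k \<Longrightarrow> \<sigma> i = \<tau> i) \<Longrightarrow> node \<sigma> k = node \<tau> k"
  by (induction k) auto

lemma u_node_convergent: "convergent (\<lambda>k. u (node \<sigma> k))"
proof (rule convergent_geometric_increments[where c = 1 and r = "1/2"])
  fix k
  have "u (node \<sigma> (Suc k)) - u (node \<sigma> k) = (1/2)^node \<sigma> (Suc k) *\<^sub>C e (node \<sigma> (Suc k))"
    using u_step[of "node \<sigma> (Suc k)"] node_gt[of "Suc k" \<sigma>] node_Suc_div[of \<sigma> k]
    by (simp del: node.simps)
  then have "norm (u (node \<sigma> (Suc k)) - u (node \<sigma> k)) = (1/2)^node \<sigma> (Suc k)"
    by (simp add: norm_scaleC e_norm norm_power norm_divide)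
  also have "\<dots> \<le> (1/2)^k"
    using node_gt[of "Suc k" \<sigma>] by (intro power_decreasing) auto
  finally show "norm (u (node \<sigma> (Suc k)) - u (node \<sigma> k)) \<le> 1 * (1/2)^k" by simp
qed simp

definition d :: "nat \<Rightarrow> real"
  where "d l = cmod (\<nu> l - 1)"

lemma d_pos: "d l > 0"
  using \<nu>_ne by (simp add: d_def)

lemma d_decay: "l < m \<Longrightarrow> 4 * d m \<le> d l"
proof (induction m)
  case (Suc m)
  have "4 * d (Suc m) \<le> d m" using \<nu>_decay by (simp add: d_def)
  moreover have "4 * d m \<le> d l" if "l < m" using Suc.IH[OF that] .
  ultimately show ?case
    using Suc.prems d_pos[of m] by (cases "l = m") auto
qed simp

lemma ev_node_step: "cmod (ev (node \<sigma> (Suc k)) - ev (node \<sigma> k)) \<le> d (node \<sigma> (Suc k))"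
  using ev_diff[of "node \<sigma> (Suc k)" 1] unfolding node_Suc_div by (simp add: d_def)

text \<open>As \<open>d\<close> decays at rate \<open>1/4\<close>, its sum along a branch is at most \<open>4/3\<close> of the first term.\<close>

lemma ev_node_diff: "cmod (ev (node \<sigma> (k + i)) - ev (node \<sigma> k)) \<le> 4/3 * d (node \<sigma> (Suc k))"
proof (induction i arbitrary: k)
  case 0
  then show ?case using d_pos[of "node \<sigma> (Suc k)"] by simp
next
  case (Suc i)
  have "cmod (ev (node \<sigma> (k + Suc i)) - ev (node \<sigma> k)) \<le>
      cmod (ev (node \<sigma> (Suc k + i)) - ev (node \<sigma> (Suc k))) + cmod (ev (node \<sigma> (Suc k)) - ev (node \<sigma> k))"
    using norm_triangle_ineq[of "ev (node \<sigma> (Suc k + i)) - ev (node \<sigma> (Suc k))"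
        "ev (node \<sigma> (Suc k)) - ev (node \<sigma> k)"] by (simp del: node.simps)
  then show ?case
    using Suc.IH[of "Suc k"] ev_node_step[of \<sigma> k] d_decay[OF node_less_Suc[of \<sigma> "Suc k"]] by linarith
qed

lemma d_le: "d l \<le> d 0 * (1/4)^l"
proof (induction l)
  case (Suc l)
  then show ?case using d_decay[of l "Suc l"] by simp
qed simp

lemma ev_node_convergent: "convergent (\<lambda>k. ev (node \<sigma> k))"
proof (rule convergent_geometric_increments[where c = "d 0" and r = "1/4"])
  fix k
  have "d (node \<sigma> (Suc k)) \<le> d 0 * (1/4)^node \<sigma> (Suc k)" by (rule d_le)
  also have "\<dots> \<le> d 0 * (1/4)^k"
    using node_gt[of "Suc k" \<sigma>] d_pos[of 0] by (intro mult_left_mono power_decreasing) auto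
  finally show "norm (ev (node \<sigma> (Suc k)) - ev (node \<sigma> k)) \<le> d 0 * (1/4)^k"
    using ev_node_step[of \<sigma> k] by linarith
qed simp

definition ev_lim :: "(nat \<Rightarrow> bool) \<Rightarrow> complex"
  where "ev_lim \<sigma> = lim (\<lambda>k. ev (node \<sigma> k))"

lemma ev_lim: "(\<lambda>k. ev (node \<sigma> k)) \<longlonglongrightarrow> ev_lim \<sigma>"
  using ev_node_convergent convergent_LIMSEQ_iff unfolding ev_lim_def by blast

lemma ev_lim_near: "cmod (ev_lim \<sigma> - ev (node \<sigma> k)) \<le> 4/3 * d (node \<sigma> (Suc k))"
proof (rule Lim_norm_ubound[OF sequentially_bot])
  show "(\<lambda>i. ev (node \<sigma> (i + k)) - ev (node \<sigma> k)) \<longlonglongrightarrow> ev_lim \<sigma> - ev (node \<sigma> k)"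
    by (intro tendsto_diff tendsto_const LIMSEQ_ignore_initial_segment ev_lim)
  show "\<forall>\<^sub>F i in sequentially. cmod (ev (node \<sigma> (i + k)) - ev (node \<sigma> k)) \<le> 4/3 * d (node \<sigma> (Suc k))"
    using ev_node_diff[of \<sigma> k] by (simp add: add.commute)
qed

text \<open>The eigenvectors along a branch converge, and the limit is not \<open>0\<close> because they all have the
  value \<open>1\<close> under \<open>\<phi> 0\<close>.\<close>

lemma ev_lim_eigenvalue: "ev_lim \<sigma> \<in> point_spectrum (A 1) \<inter> unit_circle"
proof
  obtain z where z: "(\<lambda>k. u (node \<sigma> k)) \<longlonglongrightarrow> z"
    using u_node_convergent convergent_def by blast
  note cont = bounded_linear.tendsto[OF bounded_clinearD(1)]
  have "(\<lambda>k. A 1 (u (node \<sigma> k))) \<longlonglongrightarrow> A 1 z"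
    by (rule cont[OF bounded_clinear_A z])
  moreover have "(\<lambda>k. A 1 (u (node \<sigma> k))) \<longlonglongrightarrow> ev_lim \<sigma> *\<^sub>C z"
  proof -
    have "(\<lambda>k. norm ((ev (node \<sigma> k) - ev_lim \<sigma>) *\<^sub>C u (node \<sigma> k))) \<longlonglongrightarrow> norm (ev_lim \<sigma> - ev_lim \<sigma>) * norm z"
      unfolding norm_scaleC by (intro tendsto_intros ev_lim z)
    then have "(\<lambda>k. (ev (node \<sigma> k) - ev_lim \<sigma>) *\<^sub>C u (node \<sigma> k)) \<longlonglongrightarrow> 0"
      using tendsto_norm_zero_iff by auto
    then have "(\<lambda>k. (ev (node \<sigma> k) - ev_lim \<sigma>) *\<^sub>C u (node \<sigma> k) + ev_lim \<sigma> *\<^sub>C u (node \<sigma> k))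
        \<longlonglongrightarrow> 0 + ev_lim \<sigma> *\<^sub>C z"
      by (intro tendsto_add cont[OF bounded_clinear_scaleC] z)
    then show ?thesis
      by (simp add: A_u complex_vector.scale_left_diff_distrib)
  qed
  ultimately have "A 1 z = ev_lim \<sigma> *\<^sub>C z"
    by (rule LIMSEQ_unique)
  moreover have "z \<noteq> 0"
  proof -
    have "(\<lambda>k. \<phi> 0 (u (node \<sigma> k))) \<longlonglongrightarrow> \<phi> 0 z"
      by (rule cont[OF bounded_clinear_\<phi> z])
    then have "\<phi> 0 z = 1"
      by (simp add: \<phi>_u_0 LIMSEQ_const_iff)
    then show ?thesis
      using bounded_clinearD(5)[OF bounded_clinear_\<phi>, of 0] by auto
  qed
  ultimately show "ev_lim \<sigma> \<in> point_spectrum (A 1)"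
    unfolding point_spectrum_def by auto
  have "(\<lambda>k. cmod (ev (node \<sigma> k))) \<longlonglongrightarrow> cmod (ev_lim \<sigma>)"
    by (intro tendsto_norm ev_lim)
  then show "ev_lim \<sigma> \<in> unit_circle"
    by (simp add: ev_norm LIMSEQ_const_iff unit_circle_def)
qed

text \<open>At the node \<open>m\<close> where two branches part, their eigenvalues differ by \<open>d (2 * m + 1)\<close>; all later
  steps on either branch together amount to less than half of that.\<close>

lemma inj_ev_lim: "inj ev_lim"
proof -
  have ne: "ev_lim \<sigma> \<noteq> ev_lim \<tau>"
    if \<sigma>: "\<sigma> k" and \<tau>: "\<not> \<tau> k" and eq: "\<And>i. i < k \<Longrightarrow> \<sigma> i = \<tau> i" for \<sigma> \<tau> k
  proof
    assume lim: "ev_lim \<sigma> = ev_lim \<tau>"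
    define m where "m = node \<sigma> k"
    define p where "p = 2 * m + 1"
    have m: "m > 0" "node \<tau> k = m"
      using node_gt[of k \<sigma>] node_cong[OF eq] by (simp_all add: m_def)
    have p: "node \<sigma> (Suc k) = p" "node \<tau> (Suc k) = 2 * m"
      using \<sigma> \<tau> m(2) by (simp_all add: p_def m_def)
    have "p < node \<sigma> (Suc (Suc k))" "p < node \<tau> (Suc (Suc k))"
      using m p by (simp_all add: p_def del: node.simps(2), simp_all add: p)
    then have small: "4 * d (node \<sigma> (Suc (Suc k))) \<le> d p" "4 * d (node \<tau> (Suc (Suc k))) \<le> d p"
      by (auto intro!: d_decay)
    have "ev p = ev m * \<nu> p" "ev (2 * m) = ev m"
      using m(1) ev.simps[of p] ev.simps[of "2 * m"] by (simp_all add: p_def)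
    then have "ev p - ev (2 * m) = ev m * (\<nu> p - 1)"
      by (simp add: algebra_simps)
    then have "d p = cmod ((ev_lim \<tau> - ev (2 * m)) - (ev_lim \<sigma> - ev p))"
      by (simp add: lim norm_mult ev_norm d_def)
    also have "\<dots> \<le> cmod (ev_lim \<tau> - ev (2 * m)) + cmod (ev_lim \<sigma> - ev p)"
      by (rule norm_triangle_ineq4)
    also have "\<dots> \<le> 4/3 * d (node \<tau> (Suc (Suc k))) + 4/3 * d (node \<sigma> (Suc (Suc k)))"
      using ev_lim_near[of \<tau> "Suc k"] ev_lim_near[of \<sigma> "Suc k"] unfolding p by linarith
    finally show False
      using small d_pos[of p] by linarith
  qed
  show ?thesis
  proof (rule injI, rule ccontr)
    fix \<sigma> \<tau> assume lim: "ev_lim \<sigma> = ev_lim \<tau>" and "\<sigma> \<noteq> \<tau>"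
    define k where "k = (LEAST k. \<sigma> k \<noteq> \<tau> k)"
    have "\<exists>k. \<sigma> k \<noteq> \<tau> k"
      using \<open>\<sigma> \<noteq> \<tau>\<close> by auto
    then have k: "\<sigma> k \<noteq> \<tau> k"
      unfolding k_def by (rule LeastI_ex)
    have eq: "\<sigma> i = \<tau> i" if "i < k" for i
      using not_less_Least[OF that[unfolded k_def]] by simp
    show False
      using k ne[of \<sigma> k \<tau>] ne[of \<tau> k \<sigma>] eq lim by (cases "\<sigma> k") auto
  qed
qed

lemma uncountable_spectrum: "uncountable (point_spectrum (A 1) \<inter> unit_circle)"
proof
  assume "countable (point_spectrum (A 1) \<inter> unit_circle)"
  then have "countable (range ev_lim)"
    by (rule countable_subset[rotated]) (use ev_lim_eigenvalue in blast)
  then have "countable (UNIV :: (nat \<Rightarrow> bool) set)"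
    using countable_image_inj_on inj_ev_lim by blast
  then obtain g :: "nat \<Rightarrow> nat \<Rightarrow> bool" where "surj g"
    using uncountable_def[of "UNIV :: (nat \<Rightarrow> bool) set"] by auto
  then obtain k where "g k = (\<lambda>i. \<not> g i i)"
    by (metis surj_def)
  from fun_cong[OF this, of k] show False by simp
qed

end

section \<open>Unconditional decompositions yield universal Jamison spaces\<close>

theorem theorem2p8:
  assumes "separable_space (euclidean :: 'a::complex_banach topology)"
    and "admits_unconditional_Schauder_decomposition TYPE('a)"
  shows "universal_jamison_space TYPE('a)"
proof -
  obtain M :: "nat \<Rightarrow> 'a set" where inf: "separable_infinite_dimensional TYPE('a)"
    and M: "\<forall>l. complex_vector.subspace (M l) \<and> closed (M l) \<and> M l \<noteq> {0}"
      "\<forall>x. \<exists>!u. (\<forall>l. u l \<in> M l) \<and> (u has_sum x) UNIV"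
    using assms(2) unfolding admits_unconditional_Schauder_decomposition_def by blast
  interpret unconditional_decomposition M
    by unfold_locales (use M in blast)+
  have "\<exists>v. v \<in> M l \<and> norm v = 1" for l
  proof -
    obtain x where x: "x \<in> M l" "x \<noteq> 0"
      using M(1) complex_vector.subspace_0[OF subspace, of l] by blast
    then show ?thesis
      using complex_vector.subspace_scale[OF subspace x(1), of "complex_of_real (1 / norm x)"]
      by (intro exI[of _ "complex_of_real (1 / norm x) *\<^sub>C x"]) (simp add: norm_scaleC norm_divide)
  qed
  then obtain e where e: "\<And>l. e l \<in> M l" "\<And>l. norm (e l) = 1"
    by metis
  have "\<exists>\<psi> :: 'a \<Rightarrow> complex. bounded_clinear \<psi> \<and> \<psi> (e l) = 1" for l
  proof -
    have "e l \<noteq> 0" using e(2)[of l] by auto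
    then show ?thesis by (metis separating_functional)
  qed
  then obtain \<psi> :: "nat \<Rightarrow> 'a \<Rightarrow> complex" where \<psi>: "\<And>l. bounded_clinear (\<psi> l)" "\<And>l. \<psi> l (e l) = 1"
    by metis
  have "\<exists>C. \<forall>x. cmod (\<psi> l (coord x l)) \<le> C * norm x" for l
  proof -
    have "bounded_linear (\<lambda>x. \<psi> l (coord x l))"
      using bounded_linear_compose[OF bounded_clinearD(1)[OF \<psi>(1)[of l]]
          bounded_clinearD(1)[OF bounded_clinear_coord[of l]]] .
    from bounded_linear.bounded[OF this] show ?thesis
      by (simp add: mult.commute)
  qed
  then obtain B where B: "\<And>l x. cmod (\<psi> l (coord x l)) \<le> B l * norm x"
    by metis
  have "\<exists>T \<in> (bounded_operators :: ('a \<Rightarrow> 'a) set).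
      partially_power_bounded n T \<and> uncountable (point_spectrum T \<inter> unit_circle)"
    if n: "\<not> jamison_sequence n" for n
  proof -
    \<comment> \<open>The price that a deviation of \<open>\<nu> l\<close> from \<open>1\<close> has in the operator norm, up to powers of \<open>2\<close>.\<close>
    define W where "W l = B l * norm (tree_vector e (l div 2))" for l
    have W: "W l \<ge> 0" for l
      using order_trans[OF norm_ge_zero B[of l "e l"]] e(2) by (simp add: W_def)
    have pick: "\<exists>\<nu>. cmod \<nu> = 1 \<and> \<nu> \<noteq> 1 \<and> 4 * cmod (\<nu> - 1) \<le> \<epsilon> \<and>
        (\<forall>m\<in>insert 1 (range n). cmod (\<nu> ^ m - 1) * W l \<le> (1/4)^l)" if \<epsilon>: "\<epsilon> > 0" for \<epsilon> l
    proof -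
      \<comment> \<open>\<open>W l + 1\<close> instead of \<open>W l\<close> avoids a division by \<open>0\<close>.\<close>
      define \<eta> where "\<eta> = min (\<epsilon> / 4) ((1/4)^l / (W l + 1))"
      have "\<eta> > 0" using \<epsilon> W[of l] by (simp add: \<eta>_def)
      from not_jamison_imp_small_powers[OF n this] obtain \<nu> where \<nu>: "cmod \<nu> = 1" "\<nu> \<noteq> 1"
        and small: "\<And>m. m \<in> insert 1 (range n) \<Longrightarrow> cmod (\<nu> ^ m - 1) \<le> \<eta>"
        by blast
      have "cmod (\<nu> ^ m - 1) * W l \<le> (1/4)^l" if "m \<in> insert 1 (range n)" for m
      proof -
        have "cmod (\<nu> ^ m - 1) * W l \<le> ((1/4)^l / (W l + 1)) * (W l + 1)"
          using small[OF that] W[of l] by (intro mult_mono) (auto simp: \<eta>_def)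
        then show ?thesis using W[of l] by simp
      qed
      moreover have "4 * cmod (\<nu> - 1) \<le> \<epsilon>"
        using small[of 1] by (simp add: \<eta>_def)
      ultimately show ?thesis using \<nu> by blast
    qed
    define P where "P l \<nu> \<longleftrightarrow> cmod \<nu> = 1 \<and> \<nu> \<noteq> 1 \<and>
        (\<forall>m\<in>insert 1 (range n). cmod (\<nu> ^ m - 1) * W l \<le> (1/4)^l)" for l \<nu>
    have "\<exists>\<nu>. \<forall>l. P l (\<nu> l) \<and> 4 * cmod (\<nu> (Suc l) - 1) \<le> cmod (\<nu> l - 1)"
    proof (rule dependent_nat_choice)
      show "\<exists>\<nu>. P 0 \<nu>" using pick[of 1 0] unfolding P_def by auto
      show "\<exists>\<nu>'. P (Suc l) \<nu>' \<and> 4 * cmod (\<nu>' - 1) \<le> cmod (\<nu> - 1)" if "P l \<nu>" for \<nu> l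
        using pick[of "cmod (\<nu> - 1)" "Suc l"] that unfolding P_def by auto
    qed
    then obtain \<nu> where \<nu>: "\<And>l. P l (\<nu> l)" "\<And>l. 4 * cmod (\<nu> (Suc l) - 1) \<le> cmod (\<nu> l - 1)"
      by blast
    interpret eigenvalue_tree M e \<psi> \<nu> "range n" B
      using \<nu>(1) by unfold_locales (use e \<psi> B \<nu>(2) in \<open>auto simp: P_def W_def\<close>)
    obtain K where K: "\<And>k x. norm (A (n k) x) \<le> K * norm x"
      using A_bounded_on_S by auto
    have "onorm (A 1 ^^ n k) \<le> max K 0" for k
    proof (rule onorm_bound)
      show "norm ((A 1 ^^ n k) x) \<le> max K 0 * norm x" for x
        using K[of k x] mult_right_mono[of K "max K 0" "norm x"]
        by (simp add: A_power del: One_nat_def)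
    qed simp
    then have "partially_power_bounded n (A 1)"
      unfolding partially_power_bounded_def by (intro bdd_aboveI[of _ "max K 0"]) auto
    then show ?thesis
      using uncountable_spectrum bounded_clinear_A bounded_operators_iff by blast
  qed
  then show ?thesis
    unfolding universal_jamison_space_def using inf by blast
qed

end
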